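(* Let $0<p<1$, $q=1-p$, $s>0$, $r>0$, let $X_1,X_2,\dots$ be i.i.d. random variables with $P(X_1=s r^{k-1})=p q^{k-1}$ for $k=1,2,\dots$, and let $S_m=\sum_{k=1}^m X_k$. For $n\ge 1$ put $N=r^n$ and $M=q^{-n}$. (i) If $r=1/q$, then for every fixed $u>0$, $$\frac{S_{\lfloor uN\rfloor}}{N}-s p u n\ \xrightarrow{d}\ Z(u)\quad\text{as } n\to\infty,$$ where $\{Z(u)\}_{u\ge 0}$ is the Lévy process with characteristic function $E\exp\{itZ(u)\}=\exp\{u g(t)\}$, $t\in\mathbb{R}$, and $$g(t)=\sum_{k=-\infty}^{-1}\big(e^{its r^k}-1-its r^k\big)\,p q^k+\sum_{k=0}^{\infty}\big(e^{its r^k}-1\big)\,p q^k .$$ (ii) If $r>1/q$, then for every fixed $u>0$, $$\frac{S_{\lfloor uM\rfloor}}{N}\ \xrightarrow{d}\ Z(u)\quad\text{as } n\to\infty,$$ or, equivalently, $\dfrac{1}{(rq)^n}\cdot\dfrac{S_{\lfloor uM\rfloor}}{M}\xrightarrow{d} Z(u)$ as $n\to\infty$, where now $\{Z(u)\}_{u\ge0}$ is the Lévy process with $E\exp\{itZ(u)\}=\exp\{u g(t)\}$, $t\in\mathbb{R}$, and $$g(t)=\sum_{k=-\infty}^{\infty}\big(e^{its r^k}-1\big)\,p q^k .$$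
   Context: $\xrightarrow{d}$ denotes convergence in distribution, and $\lfloor\cdot\rfloor$ denotes integer part. The limit $n\to\infty$ is taken along the positive integers. *)

theory Defs
  imports "HOL-Probability.Probability"
begin

definition conv_in_distribution ::
  "'a measure \<Rightarrow> (nat \<Rightarrow> 'a \<Rightarrow> real) \<Rightarrow> 'b measure \<Rightarrow> ('b \<Rightarrow> real) \<Rightarrow> bool" where
  "conv_in_distribution P Y Q W \<longleftrightarrow>
     weak_conv_m (\<lambda>n. distr P borel (Y n)) (distr Q borel W)"

text \<open>
  Only times \<open>u \<ge> 0\<close> are meaningful; the values of \<open>Z\<close> at negative indices are unconstrained.
  Path regularity is not part of the definition: as usual it is replaced by stochastic
  continuity, which guarantees a modification with cadlag paths.
\<close>

definition levy_process :: "'b measure \<Rightarrow> (real \<Rightarrow> 'b \<Rightarrow> real) \<Rightarrow> bool" where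
  "levy_process Q Z \<longleftrightarrow>
     prob_space Q \<and>
     (\<forall>u\<ge>0. Z u \<in> borel_measurable Q) \<and>
     (AE \<omega> in Q. Z 0 \<omega> = 0) \<and>
     (\<forall>(n::nat) (\<tau>::nat \<Rightarrow> real). 0 \<le> \<tau> 0 \<longrightarrow> (\<forall>i<n. \<tau> i < \<tau> (Suc i)) \<longrightarrow>
        prob_space.indep_vars Q (\<lambda>_. borel) (\<lambda>i \<omega>. Z (\<tau> (Suc i)) \<omega> - Z (\<tau> i) \<omega>) {..<n}) \<and>
     (\<forall>a b. 0 \<le> a \<longrightarrow> a < b \<longrightarrow>
        distr Q borel (\<lambda>\<omega>. Z b \<omega> - Z a \<omega>) = distr Q borel (Z (b - a))) \<and>
     (\<forall>a\<ge>0. \<forall>\<epsilon>>0.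
        ((\<lambda>b. measure Q {\<omega> \<in> space Q. \<bar>Z b \<omega> - Z a \<omega>\<bar> > \<epsilon>}) \<longlongrightarrow> 0) (at a within {0..}))"

definition levy_process_with_exponent ::
  "'b measure \<Rightarrow> (real \<Rightarrow> 'b \<Rightarrow> real) \<Rightarrow> (real \<Rightarrow> complex) \<Rightarrow> bool" where
  "levy_process_with_exponent Q Z g \<longleftrightarrow>
     levy_process Q Z \<and>
     (\<forall>u\<ge>0. \<forall>t. char (distr Q borel (Z u)) t = exp (complex_of_real u * g t))"

definition exponent_i :: "real \<Rightarrow> real \<Rightarrow> real \<Rightarrow> real \<Rightarrow> real \<Rightarrow> complex" where
  "exponent_i p q s r t =
     (\<Sum>\<^sub>\<infinity>k\<in>{..-1::int}.
        (exp (\<i> * of_real (t * s * r powi k)) - 1 - \<i> * of_real (t * s * r powi k))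
          * of_real (p * q powi k)) +
     (\<Sum>\<^sub>\<infinity>k\<in>{0::int..}.
        (exp (\<i> * of_real (t * s * r powi k)) - 1) * of_real (p * q powi k))"

definition exponent_ii :: "real \<Rightarrow> real \<Rightarrow> real \<Rightarrow> real \<Rightarrow> real \<Rightarrow> complex" where
  "exponent_ii p q s r t =
     (\<Sum>\<^sub>\<infinity>k\<in>(UNIV::int set).
        (exp (\<i> * of_real (t * s * r powi k)) - 1) * of_real (p * q powi k))"

end

(*
  Both limits are read off from characteristic functions. If phi is the characteristic
  function of X_1, then

    phi (t / r^n) = 1 + q^n * (sum over k >= -n of (exp (i t s r^k) - 1) p q^k),

  since scaling by r^n shifts the geometric index by n. If r q > 1 the inner sum converges
  to g t; if r q = 1 it is i t s p n plus a sum converging to g t, because every term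
  i t s r^k p q^k with k < 0 that is split off equals i t s p. Raising to the power
  floor (u q^-n) gives exp (u g t), up to the factor cancelled by the centering.

  The existence of the Levy process comes from the same convergence: exp (u g) is a pointwise
  limit of characteristic functions and continuous at 0, hence a characteristic function, and
  the resulting convolution semigroup yields a consistent family of laws of partial sums of
  independent increments, to which Kolmogorov's extension theorem applies.
*)

theory Submission
  imports Defs
begin

section \<open>Pointwise limits of characteristic functions\<close>

text \<open>Convergence is claimed for every process with the given exponent, so only
  one-dimensional laws enter there; independence and stationarity of increments belong to the
  existence claim. Two obstacles shape the proof. At \<open>r * q = 1\<close> the exponent before
  centering grows linearly in n, so the classical limit of \<open>(1 + z / m) ^ m\<close> for
  convergent \<open>z\<close> does not apply; what saves the argument is that the expansion error
  and the rounding in the integer part both carry a factor \<open>q ^ n\<close>, which outweighs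
  every power of n. For existence no candidate law is at hand: it is extracted from tightness, and
  this is where continuity of the exponent at 0 enters. At \<open>r * q = 1\<close> that continuity
  rests on the compensated small-jump terms, whose geometric ratio \<open>1 / (r^2 * q)\<close> is
  below 1.\<close>

text \<open>Both sides are iterated integrals of the bounded function
  \<open>iexp (c * t * x)\<close> over the product measure. With a normal \<open>N\<close> the
  identity trades an average of \<open>char M\<close> for the integral of a Gaussian against
  \<open>M\<close>.\<close>

lemma char_parseval:
  assumes "real_distribution M" "real_distribution N"
  shows "(CLINT t|N. char M (c * t)) = (CLINT x|M. char N (c * x))"
proof -
  interpret M: real_distribution M by fact
  interpret N: real_distribution N by fact
  interpret P: pair_prob_space M N ..
  have int: "complex_integrable (M \<Otimes>\<^sub>M N) (\<lambda>(x, t). iexp (c * t * x))"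
  proof (rule P.integrable_const_bound[where B = 1])
    show "(\<lambda>(x, t). iexp (c * t * x)) \<in> borel_measurable (M \<Otimes>\<^sub>M N)"
      by measurable
  qed (auto simp del: of_real_mult)
  have "(CLINT t|N. char M (c * t)) = (CLINT t|N. (CLINT x|M. iexp (c * t * x)))"
    by (simp add: char_def)
  also have "\<dots> = (CLINT x|M. (CLINT t|N. iexp (c * t * x)))"
    by (rule P.Fubini_integral) (use int in simp)
  also have "\<dots> = (CLINT x|M. char N (c * x))"
    by (simp add: char_def ac_simps)
  finally show ?thesis .
qed

text \<open>The usual tail estimate averages over \<open>[-\<sigma>, \<sigma>]\<close>; with a Gaussian average of scale \<open>\<sigma>\<close>
  the transformed integrand is \<open>1 - exp (- (\<sigma> * x)\<^sup>2 / 2)\<close> instead of an expression in \<open>sin\<close>.\<close>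

lemma tail_le_gaussian_average:
  assumes "real_distribution M" "\<sigma> > 0"
  shows "measure M {x. \<bar>x\<bar> \<ge> 2 / \<sigma>} \<le> 2 * Re (CLINT t|std_normal_distribution. 1 - char M (\<sigma> * t))"
proof -
  interpret M: real_distribution M by fact
  interpret G: real_distribution std_normal_distribution
    by (rule real_dist_normal_dist)
  have [measurable]: "char M \<in> borel_measurable borel"
    by (intro borel_measurable_continuous_onI continuous_at_imp_continuous_on ballI M.isCont_char)
  have iG: "complex_integrable std_normal_distribution (\<lambda>t. char M (\<sigma> * t))"
    by (rule G.integrable_const_bound[where B = 1]) (auto simp: M.cmod_char_le_1)
  have iM: "integrable M (\<lambda>x. exp (- ((\<sigma> * x)\<^sup>2) / 2))"
    by (rule M.integrable_const_bound[where B = 1]) auto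
  have "(CLINT t|std_normal_distribution. 1 - char M (\<sigma> * t))
      = 1 - (CLINT x|M. complex_of_real (exp (- ((\<sigma> * x)\<^sup>2) / 2)))"
    using iG char_parseval[OF assms(1) G.real_distribution_axioms, of \<sigma>] G.prob_space
    by (simp add: char_std_normal_distribution del: of_real_exp)
  also have "\<dots> = complex_of_real (LINT x|M. 1 - exp (- ((\<sigma> * x)\<^sup>2) / 2))"
    using iM M.prob_space by simp
  finally have eq: "Re (CLINT t|std_normal_distribution. 1 - char M (\<sigma> * t))
      = (LINT x|M. 1 - exp (- ((\<sigma> * x)\<^sup>2) / 2))" by simp
  \<comment> \<open>This fixes the constants: the threshold \<open>2 / \<sigma>\<close> means
    \<open>(\<sigma> * x)^2 / 2\<close> is at least 2, so the integrand is at least 1/2 on the tail,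
    whence the factor 2 in front of the average.\<close>
  have e2: "exp (- 2 :: real) \<le> 1 / 2"
  proof -
    have "exp (2::real) \<ge> 1 + 2" by (rule exp_ge_add_one_self)
    then show ?thesis by (simp add: exp_minus field_simps)
  qed
  have "measure M {x. \<bar>x\<bar> \<ge> 2 / \<sigma>} * (1 / 2) = (LINT x|M. indicator {x. \<bar>x\<bar> \<ge> 2 / \<sigma>} x * (1 / 2))"
    by simp
  also have "\<dots> \<le> (LINT x|M. 1 - exp (- ((\<sigma> * x)\<^sup>2) / 2))"
  proof (rule integral_mono)
    show "integrable M (\<lambda>x. indicator {x. \<bar>x\<bar> \<ge> 2 / \<sigma>} x * (1 / 2 :: real))"
      by (rule M.integrable_const_bound[where B = 1]) (auto split: split_indicator)
    show "integrable M (\<lambda>x. 1 - exp (- ((\<sigma> * x)\<^sup>2) / 2))"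
      using iM by simp
    fix x :: real
    have "exp (- ((\<sigma> * x)\<^sup>2) / 2) \<le> 1 / 2" if "\<bar>x\<bar> \<ge> 2 / \<sigma>"
    proof -
      have "2 \<le> \<sigma> * \<bar>x\<bar>" using that assms(2) by (simp add: field_simps)
      then have "2\<^sup>2 \<le> (\<sigma> * \<bar>x\<bar>)\<^sup>2" by (rule power_mono) simp
      then have "4 \<le> (\<sigma> * x)\<^sup>2" by (simp add: power_mult_distrib)
      then have "exp (- ((\<sigma> * x)\<^sup>2) / 2) \<le> exp (-2)" by simp
      with e2 show ?thesis by linarith
    qed
    then show "indicator {x. \<bar>x\<bar> \<ge> 2 / \<sigma>} x * (1 / 2) \<le> 1 - exp (- ((\<sigma> * x)\<^sup>2) / 2)"
      by (auto split: split_indicator)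
  qed
  finally show ?thesis using eq by simp
qed

text \<open>Every single distribution has vanishing tails, so the finitely many indices that escape
  a uniform eventual bound only force a larger interval.\<close>

lemma tight_of_eventually_tail_le:
  assumes M: "\<And>n. real_distribution (M n)"
    and tail: "\<And>\<epsilon>. \<epsilon> > 0 \<Longrightarrow> \<exists>K. \<forall>\<^sub>F n in sequentially. measure (M n) {x. \<bar>x\<bar> \<ge> K} < \<epsilon>"
  shows "tight M"
  unfolding tight_def
proof (intro conjI allI impI M)
  interpret M: real_distribution "M n" for n by (rule M)
  fix \<epsilon> :: real assume "\<epsilon> > 0"
  have compl: "1 - \<epsilon> < measure (M n) {-L<..L}" if "measure (M n) {x. \<bar>x\<bar> \<ge> K} < \<epsilon>" "K \<le> L" for n K L
  proof -
    have "measure (M n) (UNIV - {-L<..L}) \<le> measure (M n) {x. \<bar>x\<bar> \<ge> K}"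
      using that(2) by (intro M.finite_measure_mono) auto
    moreover have "measure (M n) (UNIV - {-L<..L}) = 1 - measure (M n) {-L<..L}"
      using M.prob_compl[of "{-L<..L}"] by simp
    ultimately show ?thesis using that(1) by linarith
  qed
  have "(\<lambda>k. measure (M n) {x. \<bar>x\<bar> \<ge> real k}) \<longlonglongrightarrow> measure (M n) (\<Inter>k. {x. \<bar>x\<bar> \<ge> real k})" for n
    by (rule M.finite_Lim_measure_decseq) (auto simp: decseq_def)
  moreover have "(\<Inter>k. {x. \<bar>x\<bar> \<ge> real k}) = {}"
  proof -
    have "\<exists>k. \<not> real k \<le> \<bar>x\<bar>" for x
      using reals_Archimedean2[of "\<bar>x\<bar>"] by (auto simp: not_le)
    then show ?thesis by blast
  qed
  ultimately have "\<forall>\<^sub>F k in sequentially. measure (M n) {x. \<bar>x\<bar> \<ge> real k} < \<epsilon>" for n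
    using \<open>\<epsilon> > 0\<close> by (intro order_tendstoD(2)) simp_all
  then have "\<exists>k. measure (M n) {x. \<bar>x\<bar> \<ge> real k} < \<epsilon>" for n
    by (rule eventually_happens'[OF sequentially_bot])
  then obtain k where k: "\<And>n. measure (M n) {x. \<bar>x\<bar> \<ge> real (k n)} < \<epsilon>"
    by metis
  obtain K n0 where K: "\<And>n. n \<ge> n0 \<Longrightarrow> measure (M n) {x. \<bar>x\<bar> \<ge> K} < \<epsilon>"
    using tail[OF \<open>\<epsilon> > 0\<close>] by (auto simp: eventually_sequentially)
  \<comment> \<open>The element 1 keeps \<open>L\<close> positive, so that
    \<open>-L < L\<close>.\<close>
  define L where "L = Max ({1, K} \<union> (\<lambda>n. real (k n)) ` {..<n0})"
  have L: "1 \<le> L" "K \<le> L" "\<And>n. n < n0 \<Longrightarrow> real (k n) \<le> L"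
    unfolding L_def by (rule Max_ge, simp, simp)+
  have "1 - \<epsilon> < measure (M n) {-L<..L}" for n
    by (cases "n < n0") (use compl[OF k L(3)] compl[OF K L(2)] in \<open>auto simp: not_less\<close>)
  then show "\<exists>a b. a < b \<and> (\<forall>n. 1 - \<epsilon> < measure (M n) {a<..b})"
    using L(1) by (intro exI[of _ "-L"] exI[of _ L]) auto
qed

text \<open>Continuity of \<open>\<phi>\<close> at 0 makes the Gaussian average of
  \<open>1 - \<phi> (\<sigma> * t)\<close> small for some \<open>\<sigma> > 0\<close>. For this
  fixed \<open>\<sigma>\<close> the averages of \<open>1 - char (M n) (\<sigma> * t)\<close>
  converge to it, so the tails are eventually uniformly small. Tightness then yields one weakly
  convergent subsequence, whose limit must have characteristic function
  \<open>\<phi>\<close>.\<close>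

theorem char_limit_is_char:
  assumes M: "\<And>n. real_distribution (M n)"
    and lim: "\<And>t. (\<lambda>n. char (M n) t) \<longlonglongrightarrow> \<phi> t"
    and cont: "isCont \<phi> 0"
  shows "\<exists>M'. real_distribution M' \<and> char M' = \<phi>"
proof -
  interpret M: real_distribution "M n" for n by (rule M)
  interpret G: real_distribution std_normal_distribution
    by (rule real_dist_normal_dist)
  have [measurable]: "char (M n) \<in> borel_measurable borel" for n
    by (intro borel_measurable_continuous_onI continuous_at_imp_continuous_on ballI M.isCont_char)
  have [measurable]: "\<phi> \<in> borel_measurable borel"
    by (rule borel_measurable_LIMSEQ_metric[OF _ lim]) auto
  have \<phi>1: "norm (\<phi> t) \<le> 1" for t
    by (rule Lim_bounded[OF tendsto_norm[OF lim]]) (auto simp: M.cmod_char_le_1)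
  have \<phi>0: "\<phi> 0 = 1"
    using lim[of 0] by (simp add: M.char_zero LIMSEQ_const_iff)
  let ?G = "std_normal_distribution"
  have b: "norm (1 - \<psi> t) \<le> 2" if "\<And>t. norm (\<psi> t) \<le> 1" for \<psi> :: "real \<Rightarrow> complex" and t
    using norm_triangle_ineq4[of 1 "\<psi> t"] that[of t] by simp
  have "(\<lambda>k. CLINT t|?G. 1 - \<phi> (1 / real (Suc k) * t)) \<longlonglongrightarrow> (CLINT t|?G. 0)"
  proof (rule integral_dominated_convergence[where w = "\<lambda>_. 2"])
    show "AE t in ?G. (\<lambda>k. 1 - \<phi> (1 / real (Suc k) * t)) \<longlonglongrightarrow> 0"
    proof (rule AE_I2)
      fix t :: real
      have "(\<lambda>k. 1 / real (Suc k) * t) \<longlonglongrightarrow> 0 * t"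
        by (intro tendsto_mult tendsto_const LIMSEQ_Suc[OF lim_1_over_n])
      then have "(\<lambda>k. \<phi> (1 / real (Suc k) * t)) \<longlonglongrightarrow> \<phi> 0"
        by (intro isCont_tendsto_compose[OF cont]) simp
      then show "(\<lambda>k. 1 - \<phi> (1 / real (Suc k) * t)) \<longlonglongrightarrow> 0"
        using \<phi>0 by (auto intro!: tendsto_eq_intros)
    qed
  qed (use b[of \<phi>] \<phi>1 in auto)
  then have small: "(\<lambda>k. 2 * Re (CLINT t|?G. 1 - \<phi> (1 / real (Suc k) * t))) \<longlonglongrightarrow> 0"
    by (auto intro!: tendsto_eq_intros)
  have "tight M"
  proof (rule tight_of_eventually_tail_le[OF M])
    fix \<epsilon> :: real assume "\<epsilon> > 0"
    then have "\<forall>\<^sub>F k in sequentially. 2 * Re (CLINT t|?G. 1 - \<phi> (1 / real (Suc k) * t)) < \<epsilon>"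
      by (rule order_tendstoD[OF small])
    then obtain k where k: "2 * Re (CLINT t|?G. 1 - \<phi> (1 / real (Suc k) * t)) < \<epsilon>"
      by (rule eventually_happens'[OF sequentially_bot, THEN exE])
    define \<sigma> where "\<sigma> = 1 / real (Suc k)"
    have "\<sigma> > 0" by (simp add: \<sigma>_def)
    have "(\<lambda>n. CLINT t|?G. 1 - char (M n) (\<sigma> * t)) \<longlonglongrightarrow> (CLINT t|?G. 1 - \<phi> (\<sigma> * t))"
      by (rule integral_dominated_convergence[where w = "\<lambda>_. 2"])
         (auto intro!: tendsto_intros lim b M.cmod_char_le_1)
    then have "(\<lambda>n. 2 * Re (CLINT t|?G. 1 - char (M n) (\<sigma> * t))) \<longlonglongrightarrow> 2 * Re (CLINT t|?G. 1 - \<phi> (\<sigma> * t))"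
      by (intro tendsto_intros)
    then have "\<forall>\<^sub>F n in sequentially. 2 * Re (CLINT t|?G. 1 - char (M n) (\<sigma> * t)) < \<epsilon>"
      using k unfolding \<sigma>_def by (rule order_tendstoD)
    then have "\<forall>\<^sub>F n in sequentially. measure (M n) {x. \<bar>x\<bar> \<ge> 2 / \<sigma>} < \<epsilon>"
      by eventually_elim (use tail_le_gaussian_average[OF M \<open>\<sigma> > 0\<close>] in \<open>auto intro: le_less_trans\<close>)
    then show "\<exists>K. \<forall>\<^sub>F n in sequentially. measure (M n) {x. \<bar>x\<bar> \<ge> K} < \<epsilon>" by blast
  qed
  from tight_imp_convergent_subsubsequence[OF this strict_mono_id]
  obtain r M' where r: "strict_mono r" "real_distribution M'" "weak_conv_m (M \<circ> r) M'"
    by auto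
  have "char M' t = \<phi> t" for t
  proof (rule LIMSEQ_unique)
    show "(\<lambda>n. char ((M \<circ> r) n) t) \<longlonglongrightarrow> char M' t"
      by (rule levy_continuity1[OF _ r(2,3)]) (simp add: M)
    show "(\<lambda>n. char ((M \<circ> r) n) t) \<longlonglongrightarrow> \<phi> t"
      using LIMSEQ_subseq_LIMSEQ[OF lim r(1)] by (simp add: o_def)
  qed
  with r(2) show ?thesis by blast
qed

section \<open>From a convolution semigroup to a Levy process\<close>

text \<open>Kolmogorov's theorem speaks of unordered finite sets of times. The left neighbour
  recovers the ordered partition from the set itself, so no sorted lists are needed; the starting
  time 0 stands in when \<open>J\<close> has no element below \<open>t\<close>.\<close>

definition previous :: "real set \<Rightarrow> real \<Rightarrow> real" where
  "previous J t = Max (insert 0 {x \<in> J. x < t})"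

context
  fixes J :: "real set"
  assumes fin: "finite J" and pos: "J \<subseteq> {0<..}"
begin

lemma previous_in: "previous J t \<in> insert 0 J"
proof -
  have "previous J t \<in> insert 0 {x \<in> J. x < t}"
    unfolding previous_def by (rule Max_in) (use fin in auto)
  then show ?thesis by auto
qed

lemma previous_less: "t > 0 \<Longrightarrow> previous J t < t"
  unfolding previous_def using fin by (subst Max_less_iff) auto

lemma le_previous: "x \<in> J \<Longrightarrow> x < t \<Longrightarrow> x \<le> previous J t"
  unfolding previous_def using fin by (intro Max_ge) auto

lemma upto_eq_insert_previous:
  "t \<in> J \<Longrightarrow> {x \<in> J. x \<le> t} = insert t {x \<in> J. x \<le> previous J t}"
  using previous_less[of t] le_previous[of _ t] pos by force

text \<open>Telescoping: passing from \<open>b\<close> to its left neighbour removes exactly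
  \<open>b\<close> from the range of summation. It is applied both to the lengths of gaps
  (\<open>f\<close> the identity) and to cumulative sums.\<close>

lemma sum_increments:
  fixes f :: "real \<Rightarrow> 'b::ab_group_add"
  assumes "b \<in> insert 0 J"
  shows "(\<Sum>x \<in> {x \<in> J. x \<le> b}. f x - f (previous J x)) = f b - f 0"
  using assms
proof (induction "card {x \<in> J. x \<le> b}" arbitrary: b rule: less_induct)
  case less
  show ?case
  proof (cases "b \<in> J")
    case False
    then have "b = 0" using less.prems by simp
    moreover from this have "{x \<in> J. x \<le> b} = {}" using pos by force
    ultimately show ?thesis by (simp only: sum.empty) simp
  next
    case True
    let ?c = "previous J b"
    have eq: "{x \<in> J. x \<le> b} = insert b {x \<in> J. x \<le> ?c}"
      by (rule upto_eq_insert_previous) fact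
    have "?c < b" using True pos by (intro previous_less) auto
    then have notin: "b \<notin> {x \<in> J. x \<le> ?c}" by simp
    have "(\<Sum>x \<in> {x \<in> J. x \<le> ?c}. f x - f (previous J x)) = f ?c - f 0"
      by (rule less.hyps[OF _ previous_in]) (use fin notin in \<open>simp add: eq\<close>)
    then show ?thesis
      unfolding eq using fin notin by simp
  qed
qed

end

text \<open>For injective \<open>f\<close> the singletons \<open>{f j}\<close> are disjoint blocks,
  so this is grouping by blocks followed by evaluation at the single coordinate. It carries
  independence indexed by times over to independence indexed by positions in a sequence.\<close>

lemma (in prob_space) indep_vars_reindex:
  assumes "indep_vars (\<lambda>_. N) X (f ` L)" "inj_on f L"
  shows "indep_vars (\<lambda>_. N) (\<lambda>j. X (f j)) L"
proof -
  have "indep_vars (\<lambda>j. PiM {f j} (\<lambda>_. N)) (\<lambda>j \<omega>. restrict (\<lambda>i. X i \<omega>) {f j}) L"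
    by (rule indep_vars_restrict[OF assms(1)])
       (use assms(2) in \<open>auto simp: disjoint_family_on_def inj_on_def\<close>)
  then have "indep_vars (\<lambda>_. N) (\<lambda>j \<omega>. (restrict (\<lambda>i. X i \<omega>) {f j}) (f j)) L"
    by (rule indep_vars_compose2[where Y = "\<lambda>j \<omega>. \<omega> (f j)"]) auto
  then show ?thesis by simp
qed

section \<open>Consistent laws of independent increments\<close>

text \<open>The semigroup law is contained in the exponential form: \<open>exp (u * g t)\<close> is
  multiplicative in \<open>u\<close>. The family \<open>\<mu>\<close> is total over the reals, with
  an arbitrary distribution at negative \<open>u\<close>, so that products over any index set are
  products of probability measures.\<close>

locale convolution_semigroup =
  fixes \<mu> :: "real \<Rightarrow> real measure" and g :: "real \<Rightarrow> complex"
  assumes real_distribution_\<mu>: "real_distribution (\<mu> u)"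
    and char_\<mu>: "u \<ge> 0 \<Longrightarrow> char (\<mu> u) t = exp (of_real u * g t)"
begin

lemma prob_space_\<mu>: "prob_space (\<mu> u)"
  using real_distribution_\<mu> by (simp add: real_distribution_def)

lemma sets_\<mu> [measurable_cong, simp]: "sets (\<mu> u) = sets borel"
  using real_distribution_\<mu>[of u] by (rule real_distribution.events_eq_borel)

text \<open>Each gap between neighbouring times is named by its right endpoint, so \<open>J\<close>
  itself indexes the increments.\<close>

definition increments :: "real set \<Rightarrow> (real \<Rightarrow> real) measure" where
  "increments J = PiM J (\<lambda>t. \<mu> (t - previous J t))"

lemma sets_increments [measurable_cong]:
  "sets (increments J) = sets (PiM J (\<lambda>_. borel))"
  unfolding increments_def by (rule sets_PiM_cong) simp_all

lemma prob_space_increments: "prob_space (increments J)"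
  unfolding increments_def by (rule prob_space_PiM) (rule prob_space_\<mu>)

lemma distr_increments_component:
  assumes "t \<in> J"
  shows "distr (increments J) borel (\<lambda>D. D t) = \<mu> (t - previous J t)"
proof -
  have "distr (increments J) borel (\<lambda>D. D t)
      = distr (increments J) (\<mu> (t - previous J t)) (\<lambda>D. D t)"
    by (rule distr_cong) simp_all
  also have "\<dots> = \<mu> (t - previous J t)"
    unfolding increments_def by (rule distr_PiM_component) (use assms prob_space_\<mu> in auto)
  finally show ?thesis .
qed

lemma distr_restrict_increments:
  "distr (increments J) (PiM J (\<lambda>_. borel)) (\<lambda>D. restrict D J) = increments J"
proof -
  have "distr (increments J) (PiM J (\<lambda>_. borel)) (\<lambda>D. restrict D J)
      = distr (increments J) (increments J) (\<lambda>D. D)"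
  proof (rule distr_cong)
    fix D assume "D \<in> space (increments J)"
    then show "restrict D J = D"
      using sets_eq_imp_space_eq[OF sets_increments[of J]]
      by (simp add: space_PiM PiE_def extensional_restrict)
  qed (simp_all add: sets_increments)
  then show ?thesis by simp
qed

lemma indep_vars_increments:
  "prob_space.indep_vars (increments J) (\<lambda>_. borel) (\<lambda>t D. D t) J"
proof (cases "J = {}")
  case True
  interpret prob_space "increments {}" by (rule prob_space_increments)
  show ?thesis unfolding True by (simp add: indep_vars_def2 indep_sets_def)
next
  case False
  interpret prob_space "increments J" by (rule prob_space_increments)
  have "distr (increments J) (PiM J (\<lambda>_. borel)) (\<lambda>D. \<lambda>t\<in>J. D t)
      = increments J"
    by (rule distr_restrict_increments)
  also have "\<dots> = (\<Pi>\<^sub>M t\<in>J. distr (increments J) borel (\<lambda>D. D t))"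
    by (subst increments_def, rule PiM_cong) (simp_all add: distr_increments_component)
  finally show ?thesis
    by (subst indep_vars_iff_distr_eq_PiM'[OF False]) simp_all
qed

text \<open>This is the consistency of the increments under refinement. A gap of \<open>J\<close>
  splits into gaps of \<open>H\<close>; sums over disjoint blocks stay independent, and the
  characteristic function of a block sum is a product of exponentials whose lengths telescope to the
  length of the gap of \<open>J\<close>.\<close>

lemma distr_block_sums:
  assumes H: "finite H" "H \<subseteq> {0<..}" and JH: "J \<subseteq> H"
  shows "distr (increments H) (PiM J (\<lambda>_. borel))
      (\<lambda>D. \<lambda>t\<in>J. \<Sum>y | y \<in> H \<and> previous J t < y \<and> y \<le> t. D y) = increments J"
proof -
  have J: "finite J" "J \<subseteq> {0<..}" using H JH by (auto intro: finite_subset)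
  interpret prob_space "increments H" by (rule prob_space_increments)
  define K where "K t = {y \<in> H. previous J t < y \<and> y \<le> t}" for t
  have K: "K t \<subseteq> H" "finite (K t)" for t using H by (auto simp: K_def)
  have indep: "indep_vars (\<lambda>_. borel) (\<lambda>t D. \<Sum>y\<in>K t. D y) J"
  proof -
    have "disjoint_family_on K J"
      unfolding disjoint_family_on_def
    proof (intro ballI impI)
      fix s t assume "s \<in> J" "t \<in> J" "s \<noteq> t"
      then show "K s \<inter> K t = {}"
        using le_previous[OF J, of s t] le_previous[OF J, of t s]
        by (cases s t rule: linorder_cases) (auto simp: K_def)
    qed
    then have "indep_vars (\<lambda>t. PiM (K t) (\<lambda>_. borel)) (\<lambda>t D. restrict (\<lambda>y. D y) (K t)) J"
      by (intro indep_vars_restrict[OF indep_vars_increments] K)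
    then have "indep_vars (\<lambda>_. borel) (\<lambda>t D. \<Sum>y\<in>K t. (restrict (\<lambda>y. D y) (K t)) y) J"
      by (rule indep_vars_compose2[where Y = "\<lambda>t D. \<Sum>y\<in>K t. D y"]) auto
    then show ?thesis by simp
  qed
  have law: "distr (increments H) borel (\<lambda>D. \<Sum>y\<in>K t. D y) = \<mu> (t - previous J t)" if t: "t \<in> J" for t
  proof (rule Levy_uniqueness)
    have "K t = {y \<in> H. y \<le> t} - {y \<in> H. y \<le> previous J t}" by (auto simp: K_def)
    moreover have "t > 0" using t J by auto
    then have "{y \<in> H. y \<le> previous J t} \<subseteq> {y \<in> H. y \<le> t}"
      using previous_less[OF J] by force
    ultimately have "(\<Sum>y\<in>K t. y - previous H y)
        = (\<Sum>y\<in>{y \<in> H. y \<le> t}. y - previous H y) - (\<Sum>y\<in>{y \<in> H. y \<le> previous J t}. y - previous H y)"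
      using H by (simp add: sum_diff)
    also have "\<dots> = (t - 0) - (previous J t - 0)"
    proof (rule arg_cong2[where f = minus])
      show "(\<Sum>y\<in>{y \<in> H. y \<le> t}. y - previous H y) = t - 0"
        by (rule sum_increments[OF H]) (use t JH in auto)
      show "(\<Sum>y\<in>{y \<in> H. y \<le> previous J t}. y - previous H y) = previous J t - 0"
        by (rule sum_increments[OF H]) (use JH previous_in[OF J, of t] in auto)
    qed
    also have "\<dots> = t - previous J t" by simp
    finally have len: "(\<Sum>y\<in>K t. y - previous H y) = t - previous J t" .
    show "char (distr (increments H) borel (\<lambda>D. \<Sum>y\<in>K t. D y)) = char (\<mu> (t - previous J t))"
    proof
      fix x
      have "char (distr (increments H) borel (\<lambda>D. \<Sum>y\<in>K t. D y)) x
          = (\<Prod>y\<in>K t. char (distr (increments H) borel (\<lambda>D. D y)) x)"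
        by (rule char_distr_sum) (rule indep_vars_subset[OF indep_vars_increments K(1)])
      also have "\<dots> = (\<Prod>y\<in>K t. exp (of_real (y - previous H y) * g x))"
      proof (rule prod.cong[OF refl])
        fix y assume "y \<in> K t"
        then have "y \<in> H" by (auto simp: K_def)
        with H have "previous H y < y" by (intro previous_less) auto
        with \<open>y \<in> H\<close> show "char (distr (increments H) borel (\<lambda>D. D y)) x = exp (of_real (y - previous H y) * g x)"
          by (simp add: distr_increments_component char_\<mu>)
      qed
      also have "\<dots> = exp (of_real (\<Sum>y\<in>K t. y - previous H y) * g x)"
        using K by (simp add: exp_sum sum_distrib_right)
      also have "\<dots> = char (\<mu> (t - previous J t)) x"
        using previous_less[OF J \<open>t > 0\<close>] by (simp add: len char_\<mu>)
      finally show "char (distr (increments H) borel (\<lambda>D. \<Sum>y\<in>K t. D y)) x = char (\<mu> (t - previous J t)) x" .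
    qed
    have [measurable]: "(\<lambda>D. \<Sum>y\<in>K t. D y) \<in> borel_measurable (increments H)"
      using indep t by (auto simp: indep_vars_def)
    show "real_distribution (distr (increments H) borel (\<lambda>D. \<Sum>y\<in>K t. D y))"
      by simp
  qed (rule real_distribution_\<mu>)
  show ?thesis
  proof (cases "J = {}")
    \<comment> \<open>Over the empty index set both sides are probability measures on a one-point
      space, so comparing total mass is enough.\<close>
    case True
    interpret E: prob_space "distr (increments H) (PiM {} (\<lambda>_. borel)) (\<lambda>D. \<lambda>t\<in>({}::real set). 0::real)"
      by (rule prob_space_distr) (rule measurable_restrict, simp)
    interpret product_sigma_finite "\<lambda>t. \<mu> (t - previous J t)"
      by (rule product_sigma_finite.intro)
         (intro prob_space_imp_sigma_finite prob_space_\<mu>)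
    show ?thesis
      unfolding increments_def[of J]
    proof (rule PiM_eqI)
      fix A :: "real \<Rightarrow> real set"
      show "emeasure (distr (increments H) (PiM J (\<lambda>_. borel))
          (\<lambda>D. \<lambda>t\<in>J. \<Sum>y | y \<in> H \<and> previous J t < y \<and> y \<le> t. D y)) (Pi\<^sub>E J A)
        = (\<Prod>t\<in>J. emeasure (\<mu> (t - previous J t)) (A t))"
        using True E.emeasure_space_1 by (simp add: space_PiM restrict_def)
    qed (simp_all add: True PiM_empty)
  next
    case False
    have "distr (increments H) (PiM J (\<lambda>_. borel)) (\<lambda>D. \<lambda>t\<in>J. \<Sum>y\<in>K t. D y)
        = (\<Pi>\<^sub>M t\<in>J. distr (increments H) borel (\<lambda>D. \<Sum>y\<in>K t. D y))"
      by (rule indep_vars_iff_distr_eq_PiM'[THEN iffD1, OF False _ indep])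
         (use indep in \<open>simp add: indep_vars_def\<close>)
    also have "\<dots> = increments J"
      unfolding increments_def[of J] by (rule PiM_cong) (simp_all add: law)
    finally show ?thesis by (simp add: K_def)
  qed
qed

definition fdd :: "real set \<Rightarrow> (real \<Rightarrow> real) measure" where
  "fdd J = distr (increments J) (PiM J (\<lambda>_. borel)) (\<lambda>D. \<lambda>t\<in>J. \<Sum>x\<in>{x \<in> J. x \<le> t}. D x)"

lemma sets_fdd [measurable_cong]: "sets (fdd J) = sets (PiM J (\<lambda>_. borel))"
  by (simp add: fdd_def)

lemma cumulative_measurable [measurable]:
  "(\<lambda>D. \<lambda>t\<in>J. \<Sum>x\<in>{x \<in> H. x \<le> t}. D x :: real) \<in> PiM H (\<lambda>_. borel) \<rightarrow>\<^sub>M PiM J (\<lambda>_. borel)"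
  by (intro measurable_restrict borel_measurable_sum) auto

text \<open>Forming cumulative sums commutes with dropping times: at \<open>t\<close> in
  \<open>J\<close>, summing the increments over \<open>H\<close> up to \<open>t\<close> equals
  summing the block sums over \<open>J\<close> up to \<open>t\<close>. Consistency of the paths thus
  reduces to consistency of the increments.\<close>

lemma projective_family_fdd: "projective_family {0<..} fdd (\<lambda>_. borel)"
proof (rule projective_family.intro)
  fix J H :: "real set"
  assume JH: "J \<subseteq> H" and H: "finite H" "H \<subseteq> {0<..}"
  have J: "finite J" "J \<subseteq> {0<..}" using H JH by (auto intro: finite_subset)
  let ?block = "\<lambda>D. \<lambda>t\<in>J. \<Sum>y | y \<in> H \<and> previous J t < y \<and> y \<le> t. D y :: real"
  have [measurable]: "?block \<in> PiM H (\<lambda>_. borel) \<rightarrow>\<^sub>M PiM J (\<lambda>_. borel)"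
    by (intro measurable_restrict borel_measurable_sum) auto
  have [measurable]: "(\<lambda>f. restrict f J) \<in> PiM H (\<lambda>_. borel) \<rightarrow>\<^sub>M PiM J (\<lambda>_. borel :: real measure)"
    using JH by (rule measurable_restrict_subset)
  have cum: "(\<Sum>x\<in>{x \<in> J. x \<le> t}. ?block D x) = (\<Sum>x\<in>{x \<in> H. x \<le> t}. D x)" if t: "t \<in> J" for D t
  proof -
    let ?F = "\<lambda>b. \<Sum>y\<in>{y \<in> H. y \<le> b}. D y"
    have "?block D x = ?F x - ?F (previous J x)" if "x \<in> J" for x
    proof -
      have "previous J x < x" using that J by (intro previous_less) auto
      then have "{y \<in> H. y \<le> previous J x} \<subseteq> {y \<in> H. y \<le> x}" by auto
      moreover have "{y. y \<in> H \<and> previous J x < y \<and> y \<le> x} = {y \<in> H. y \<le> x} - {y \<in> H. y \<le> previous J x}"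
        by auto
      ultimately show ?thesis using that H by (simp add: sum_diff)
    qed
    then have "(\<Sum>x\<in>{x \<in> J. x \<le> t}. ?block D x) = (\<Sum>x\<in>{x \<in> J. x \<le> t}. ?F x - ?F (previous J x))"
      by (intro sum.cong) auto
    also have "\<dots> = ?F t - ?F 0"
      by (rule sum_increments[OF J]) (use t in simp)
    also have "{y \<in> H. y \<le> 0} = {}" using H by force
    finally show ?thesis by simp
  qed
  have "fdd J = distr (distr (increments H) (PiM J (\<lambda>_. borel)) ?block) (PiM J (\<lambda>_. borel))
      (\<lambda>D. \<lambda>t\<in>J. \<Sum>x\<in>{x \<in> J. x \<le> t}. D x)"
    unfolding fdd_def distr_block_sums[OF H JH] ..
  also have "\<dots> = distr (increments H) (PiM J (\<lambda>_. borel))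
      (\<lambda>D. \<lambda>t\<in>J. \<Sum>x\<in>{x \<in> J. x \<le> t}. ?block D x)"
    by (subst distr_distr) (simp_all add: o_def)
  also have "\<dots> = distr (increments H) (PiM J (\<lambda>_. borel))
      (\<lambda>D. restrict (\<lambda>t\<in>H. \<Sum>x\<in>{x \<in> H. x \<le> t}. D x) J)"
  proof (rule distr_cong[OF refl refl])
    fix D :: "real \<Rightarrow> real"
    have "restrict (\<lambda>t\<in>H. \<Sum>x\<in>{x \<in> H. x \<le> t}. D x) J = (\<lambda>t\<in>J. \<Sum>x\<in>{x \<in> H. x \<le> t}. D x)"
      using JH by (auto simp: fun_eq_iff restrict_def)
    also have "\<dots> = (\<lambda>t\<in>J. \<Sum>x\<in>{x \<in> J. x \<le> t}. ?block D x)"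
      by (rule restrict_ext) (rule cum[symmetric])
    finally show "(\<lambda>t\<in>J. \<Sum>x\<in>{x \<in> J. x \<le> t}. ?block D x)
        = restrict (\<lambda>t\<in>H. \<Sum>x\<in>{x \<in> H. x \<le> t}. D x) J" ..
  qed
  also have "\<dots> = distr (fdd H) (PiM J (\<lambda>_. borel)) (\<lambda>f. restrict f J)"
    unfolding fdd_def by (subst distr_distr) (simp_all add: o_def)
  finally show "fdd J = distr (fdd H) (PiM J (\<lambda>_. borel)) (\<lambda>f. restrict f J)" .
next
  fix J :: "real set" assume "finite J" "J \<subseteq> {0<..}"
  interpret prob_space "increments J" by (rule prob_space_increments)
  show "prob_space (fdd J)"
    unfolding fdd_def by (rule prob_space_distr) measurable
qed

section \<open>The process on path space\<close>

sublocale kolmogorov: polish_projective "{0<..}" fdd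
  unfolding polish_projective_def by (rule projective_family_fdd)

abbreviation path_measure :: "(real \<Rightarrow> real) measure" where
  "path_measure \<equiv> kolmogorov.lim"

text \<open>Time 0 is not an index of the projective family: the process is set to 0 there, so that
  the values at a finite set of positive times are exactly the partial sums of the increments.\<close>

definition process :: "real \<Rightarrow> (real \<Rightarrow> real) \<Rightarrow> real" where
  "process u \<omega> = (if u > 0 then \<omega> u else 0)"

lemma process_measurable [measurable]: "process u \<in> borel_measurable path_measure"
  unfolding process_def measurable_cong_sets[OF kolmogorov.sets_lim refl]
  by (cases "u > 0") simp_all

lemma process_measurable_PiM:
  "u \<in> insert 0 J \<Longrightarrow> J \<subseteq> {0<..} \<Longrightarrow> process u \<in> borel_measurable (PiM J (\<lambda>_. borel))"
  unfolding process_def by (cases "u > 0") auto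

lemma distr_path_restrict:
  assumes "finite J" "J \<subseteq> {0<..}"
  shows "distr path_measure (PiM J (\<lambda>_. borel)) (\<lambda>\<omega>. restrict \<omega> J) = fdd J"
proof (rule measure_eqI)
  fix X assume "X \<in> sets (distr path_measure (PiM J (\<lambda>_. borel)) (\<lambda>\<omega>. restrict \<omega> J))"
  then have X: "X \<in> sets (PiM J (\<lambda>_. borel))" by simp
  have "emeasure (distr path_measure (PiM J (\<lambda>_. borel)) (\<lambda>\<omega>. restrict \<omega> J)) X
      = emeasure path_measure ((\<lambda>\<omega>. restrict \<omega> J) -` X \<inter> space path_measure)"
  proof (rule emeasure_distr[OF _ X])
    show "(\<lambda>\<omega>. restrict \<omega> J) \<in> path_measure \<rightarrow>\<^sub>M PiM J (\<lambda>_. borel)"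
      unfolding measurable_cong_sets[OF kolmogorov.sets_lim refl]
      by (rule measurable_restrict_subset) fact
  qed
  also have "(\<lambda>\<omega>. restrict \<omega> J) -` X \<inter> space path_measure = prod_emb {0<..} (\<lambda>_. borel) J X"
    by (simp add: prod_emb_def space_PiM)
  also have "emeasure path_measure \<dots> = emeasure (fdd J) X"
    by (rule kolmogorov.emeasure_lim_emb) (use assms X in auto)
  finally show "emeasure (distr path_measure (PiM J (\<lambda>_. borel)) (\<lambda>\<omega>. restrict \<omega> J)) X = emeasure (fdd J) X" .
qed (simp add: sets_fdd)

text \<open>Taking differences of neighbours inverts the cumulative sums that define
  \<open>fdd\<close>, so the original product law reappears.\<close>

lemma distr_process_increments:
  assumes J: "finite J" "J \<subseteq> {0<..}"
  shows "distr path_measure (PiM J (\<lambda>_. borel)) (\<lambda>\<omega>. \<lambda>x\<in>J. process x \<omega> - process (previous J x) \<omega>)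
    = increments J"
proof -
  let ?d = "\<lambda>\<omega>. \<lambda>x\<in>J. process x \<omega> - process (previous J x) \<omega>"
  let ?c = "\<lambda>D. \<lambda>t\<in>J. \<Sum>x\<in>{x \<in> J. x \<le> t}. D x :: real"
  have [measurable]: "?d \<in> PiM J (\<lambda>_. borel) \<rightarrow>\<^sub>M PiM J (\<lambda>_. borel)"
    using J previous_in[OF J]
    by (intro measurable_restrict borel_measurable_diff process_measurable_PiM) auto
  have [measurable]: "(\<lambda>\<omega>. restrict \<omega> J) \<in> path_measure \<rightarrow>\<^sub>M PiM J (\<lambda>_. borel)"
    unfolding measurable_cong_sets[OF kolmogorov.sets_lim refl]
    by (rule measurable_restrict_subset) fact
  have proc_restrict: "process x (restrict \<omega> J) = process x \<omega>" if "x \<in> insert 0 J" for x \<omega>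
    using that by (auto simp: process_def)
  have proc_cum: "process t (?c D) = (\<Sum>x\<in>{x \<in> J. x \<le> t}. D x)" if "t \<in> insert 0 J" for t D
  proof (cases "t \<in> J")
    case True
    with J show ?thesis by (auto simp: process_def)
  next
    case False
    with that have "t = 0" by simp
    moreover have "{x \<in> J. x \<le> 0} = {}" using J by force
    ultimately show ?thesis by (simp only: process_def) simp
  qed
  have inverse: "?d (?c D) = restrict D J" for D
  proof (rule restrict_ext)
    fix t assume t: "t \<in> J"
    then have "previous J t < t" using J by (intro previous_less) auto
    then have split: "(\<Sum>x\<in>{x \<in> J. x \<le> t}. D x) = D t + (\<Sum>x\<in>{x \<in> J. x \<le> previous J t}. D x)"
      unfolding upto_eq_insert_previous[OF J t] using J by simp
    show "process t (?c D) - process (previous J t) (?c D) = D t"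
      unfolding proc_cum[OF insertI2[OF t]] proc_cum[OF previous_in[OF J]] split by simp
  qed
  have "distr path_measure (PiM J (\<lambda>_. borel)) ?d
      = distr path_measure (PiM J (\<lambda>_. borel)) (\<lambda>\<omega>. ?d (restrict \<omega> J))"
    using previous_in[OF J] by (intro distr_cong refl restrict_ext) (simp only: proc_restrict insertI2)
  also have "\<dots> = distr (fdd J) (PiM J (\<lambda>_. borel)) ?d"
    unfolding distr_path_restrict[OF J, symmetric] by (subst distr_distr) (simp_all add: o_def)
  also have "\<dots> = distr (increments J) (PiM J (\<lambda>_. borel)) (\<lambda>D. ?d (?c D))"
    unfolding fdd_def by (subst distr_distr) (simp_all add: o_def)
  also have "\<dots> = increments J"
    unfolding inverse by (rule distr_restrict_increments)
  finally show ?thesis .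
qed

lemma indep_vars_process_increments:
  assumes J: "finite J" "J \<subseteq> {0<..}" "J \<noteq> {}"
  shows "kolmogorov.P.indep_vars (\<lambda>_. borel) (\<lambda>x \<omega>. process x \<omega> - process (previous J x) \<omega>) J"
    (is "kolmogorov.P.indep_vars _ ?D J")
    and "x \<in> J \<Longrightarrow> distr path_measure borel (\<lambda>\<omega>. process x \<omega> - process (previous J x) \<omega>)
      = \<mu> (x - previous J x)"
proof -
  have [measurable]: "(\<lambda>\<omega>. \<lambda>x\<in>J. ?D x \<omega>) \<in> path_measure \<rightarrow>\<^sub>M PiM J (\<lambda>_. borel)"
    by (rule measurable_restrict) measurable
  show law: "distr path_measure borel (?D x) = \<mu> (x - previous J x)" if x: "x \<in> J" for x
  proof -
    have "\<mu> (x - previous J x)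
        = distr (distr path_measure (PiM J (\<lambda>_. borel)) (\<lambda>\<omega>. \<lambda>x\<in>J. ?D x \<omega>)) borel (\<lambda>D. D x)"
      unfolding distr_process_increments[OF J(1,2)] by (rule distr_increments_component[OF x, symmetric])
    also have "\<dots> = distr path_measure borel (?D x)"
      using x by (subst distr_distr) (simp_all add: o_def)
    finally show ?thesis ..
  qed
  have "distr path_measure (PiM J (\<lambda>_. borel)) (\<lambda>\<omega>. \<lambda>x\<in>J. ?D x \<omega>)
      = (\<Pi>\<^sub>M x\<in>J. distr path_measure borel (?D x))"
    unfolding distr_process_increments[OF J(1,2)] increments_def
    by (rule PiM_cong) (simp_all add: law)
  then show "kolmogorov.P.indep_vars (\<lambda>_. borel) ?D J"
    by (subst kolmogorov.P.indep_vars_iff_distr_eq_PiM'[OF J(3)]) simp_all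
qed

lemma distr_process_diff:
  assumes "0 \<le> a" "a < b"
  shows "distr path_measure borel (\<lambda>\<omega>. process b \<omega> - process a \<omega>) = \<mu> (b - a)"
proof -
  \<comment> \<open>Removing 0 keeps the index set within the positive times; when
    \<open>a = 0\<close>, the default value of \<open>previous\<close> supplies it again.\<close>
  have "previous ({a, b} - {0}) b = a"
    unfolding previous_def by (rule Max_eqI) (use assms in auto)
  moreover have "{a, b} - {0} \<subseteq> {0<..}" using assms by auto
  ultimately show ?thesis
    using indep_vars_process_increments(2)[of "{a, b} - {0}" b] assms by auto
qed

lemma distr_process:
  assumes "u \<ge> 0"
  shows "distr path_measure borel (process u) = \<mu> u"
proof (cases "u = 0")
  case True
  show ?thesis
  proof (rule Levy_uniqueness)
    show "char (distr path_measure borel (process u)) = char (\<mu> u)"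
      using True kolmogorov.P.prob_space
      by (auto simp: char_def[of "distr _ _ _"] integral_distr process_def char_\<mu> simp del: kolmogorov.P.distr_const)
  qed (use real_distribution_\<mu> in auto)
next
  case False
  with assms distr_process_diff[of 0 u] show ?thesis by (simp add: process_def[of 0])
qed

text \<open>As \<open>h i\<close> tends to 0 the characteristic functions
  \<open>exp (h i * g t)\<close> tend to 1, so the laws converge weakly to the point mass at 0, and
  0 is not on the frontier of \<open>{x. \<bar>x\<bar> > \<epsilon>}\<close>.\<close>

lemma tail_tendsto_0:
  assumes h: "\<And>i. h i \<ge> 0" "h \<longlonglongrightarrow> 0" and "\<epsilon> > 0"
  shows "(\<lambda>i. measure (\<mu> (h i)) {x. \<bar>x\<bar> > \<epsilon>}) \<longlonglongrightarrow> 0"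
proof -
  have rd: "real_distribution (return borel 0)"
    by (simp add: real_distribution_def real_distribution_axioms_def prob_space_return)
  have "weak_conv_m (\<lambda>i. \<mu> (h i)) (return borel 0)"
  proof (rule levy_continuity)
    fix t
    have "(\<lambda>i. exp (of_real (h i) * g t)) \<longlonglongrightarrow> exp (of_real 0 * g t)"
      by (intro tendsto_intros h)
    then show "(\<lambda>i. char (\<mu> (h i)) t) \<longlonglongrightarrow> char (return borel 0) t"
      by (simp add: char_\<mu> h) (simp add: char_def integral_return)
  qed (use rd real_distribution_\<mu> in auto)
  moreover have "emeasure (return borel 0) (frontier {x. \<bar>x\<bar> > \<epsilon>}) = 0"
  proof -
    have "closure {x::real. \<bar>x\<bar> > \<epsilon>} \<subseteq> {x. \<bar>x\<bar> \<ge> \<epsilon>}"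
      by (rule closure_minimal) (auto intro!: closed_Collect_le continuous_intros)
    then have "0 \<notin> frontier {x::real. \<bar>x\<bar> > \<epsilon>}" using \<open>\<epsilon> > 0\<close> by (auto simp: frontier_def)
    then show ?thesis by simp
  qed
  ultimately have "(\<lambda>i. measure (\<mu> (h i)) {x. \<bar>x\<bar> > \<epsilon>}) \<longlonglongrightarrow> measure (return borel 0) {x. \<bar>x\<bar> > \<epsilon>}"
    by (intro weak_conv_imp_continuity_set_conv rd real_distribution_\<mu>) auto
  then show ?thesis using \<open>\<epsilon> > 0\<close> by (simp add: measure_def)
qed

text \<open>By stationarity the probability depends only on the distance of the two times, so
  approach from the left and from the right are handled by the same tail estimate.\<close>

lemma process_stochastically_continuous:
  assumes "0 \<le> a" "\<epsilon> > 0"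
  shows "((\<lambda>b. measure path_measure {\<omega> \<in> space path_measure. \<bar>process b \<omega> - process a \<omega>\<bar> > \<epsilon>})
    \<longlongrightarrow> 0) (at a within {0..})"
  unfolding tendsto_at_iff_sequentially
proof (intro allI impI)
  fix X :: "nat \<Rightarrow> real" assume X: "\<forall>i. X i \<in> {0..} - {a}" "X \<longlonglongrightarrow> a"
  have ordered: "measure path_measure {\<omega> \<in> space path_measure. \<bar>process d \<omega> - process c \<omega>\<bar> > \<epsilon>}
      = measure (\<mu> (d - c)) {x. \<bar>x\<bar> > \<epsilon>}" if "0 \<le> c" "c < d" for c d
    unfolding distr_process_diff[OF that, symmetric]
    by (subst measure_distr) (auto intro!: arg_cong[where f = "measure path_measure"])
  have "measure path_measure {\<omega> \<in> space path_measure. \<bar>process (X i) \<omega> - process a \<omega>\<bar> > \<epsilon>}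
      = measure (\<mu> \<bar>X i - a\<bar>) {x. \<bar>x\<bar> > \<epsilon>}" for i
  proof (cases "X i < a")
    case True
    with ordered[of "X i" a] X(1) show ?thesis by (simp add: abs_minus_commute)
  next
    case False
    then have "a < X i" using X(1) by (metis Diff_iff insertCI linorder_neqE_linordered_idom)
    with ordered[of a "X i"] assms show ?thesis by simp
  qed
  moreover have "(\<lambda>i. \<bar>X i - a\<bar>) \<longlonglongrightarrow> 0"
    using X(2) by (simp add: LIM_zero_iff tendsto_rabs_zero_iff)
  then have "(\<lambda>i. measure (\<mu> \<bar>X i - a\<bar>) {x. \<bar>x\<bar> > \<epsilon>}) \<longlonglongrightarrow> 0"
    using assms(2) by (intro tail_tendsto_0) auto
  ultimately show "((\<lambda>b. measure path_measure {\<omega> \<in> space path_measure. \<bar>process b \<omega> - process a \<omega>\<bar> > \<epsilon>})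
      \<circ> X) \<longlonglongrightarrow> 0"
    by (simp add: o_def)
qed

text \<open>In the set of positive values of \<open>\<tau>\<close> the left neighbour of
  \<open>\<tau> (Suc i)\<close> is \<open>\<tau> i\<close>, also when \<open>\<tau> 0 = 0\<close>.
  If \<open>\<tau> 0 > 0\<close>, that set yields one further increment, from time 0 to
  \<open>\<tau> 0\<close>, which is dropped by passing to a subfamily.\<close>

lemma indep_vars_increments_along:
  fixes \<tau> :: "nat \<Rightarrow> real"
  assumes "0 \<le> \<tau> 0" and step: "\<And>i. i < n \<Longrightarrow> \<tau> i < \<tau> (Suc i)"
  shows "kolmogorov.P.indep_vars (\<lambda>_. borel)
    (\<lambda>i \<omega>. process (\<tau> (Suc i)) \<omega> - process (\<tau> i) \<omega>) {..<n}"
proof (cases "n = 0")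
  case True
  then show ?thesis by (simp add: kolmogorov.P.indep_vars_def2 kolmogorov.P.indep_sets_def)
next
  case False
  have less: "\<tau> i < \<tau> j" if "i < j" "j \<le> n" for i j
    using that
  proof (induction j)
    case (Suc j)
    then have "\<tau> i \<le> \<tau> j" by (cases "i = j") auto
    also have "\<tau> j < \<tau> (Suc j)" using Suc.prems by (intro step) auto
    finally show ?case .
  qed simp
  have inj: "inj_on (\<lambda>i. \<tau> (Suc i)) {..<n}"
  proof (rule inj_onI)
    fix i j assume "i \<in> {..<n}" "j \<in> {..<n}" "\<tau> (Suc i) = \<tau> (Suc j)"
    then show "i = j"
      using less[of "Suc i" "Suc j"] less[of "Suc j" "Suc i"] by (cases i j rule: linorder_cases) auto
  qed
  have pos: "0 < \<tau> (Suc i)" if "i < n" for i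
    using less[of 0 "Suc i"] that assms(1) by simp
  define J where "J = \<tau> ` {..n} - {0}"
  have J: "finite J" "J \<subseteq> {0<..}"
  proof -
    have "\<tau> k \<ge> 0" if "k \<le> n" for k using that pos[of "k - 1"] assms(1) by (cases k) auto
    then show "J \<subseteq> {0<..}" by (force simp: J_def less_le)
  qed (simp add: J_def)
  have sub: "(\<lambda>i. \<tau> (Suc i)) ` {..<n} \<subseteq> J" using pos by (force simp: J_def)
  then have "J \<noteq> {}" using False by auto
  have prev: "previous J (\<tau> (Suc i)) = \<tau> i" if i: "i < n" for i
    unfolding previous_def
  proof (rule Max_eqI)
    show "\<tau> i \<in> insert 0 {x \<in> J. x < \<tau> (Suc i)}" using i step by (auto simp: J_def)
    fix y assume y: "y \<in> insert 0 {x \<in> J. x < \<tau> (Suc i)}"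
    have "0 \<le> \<tau> i" using assms(1) pos[of "i - 1"] i by (cases i) auto
    moreover have "\<tau> k \<le> \<tau> i" if "k \<le> n" "\<tau> k < \<tau> (Suc i)" for k
    proof -
      have "k \<le> i"
      proof (rule ccontr)
        assume "\<not> k \<le> i"
        then have "k = Suc i \<or> Suc i < k" by auto
        then show False using less[of "Suc i" k] that by auto
      qed
      then show ?thesis using less[of k i] i by (cases "k = i") auto
    qed
    ultimately show "y \<le> \<tau> i" using y by (auto simp: J_def)
  qed (use J in simp)
  have "kolmogorov.P.indep_vars (\<lambda>_. borel)
      (\<lambda>i \<omega>. process (\<tau> (Suc i)) \<omega> - process (previous J (\<tau> (Suc i))) \<omega>) {..<n}"
    by (rule kolmogorov.P.indep_vars_reindex[OF _ inj])
       (rule kolmogorov.P.indep_vars_subset[OF indep_vars_process_increments(1)[OF J \<open>J \<noteq> {}\<close>] sub])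
  then show ?thesis
    by (rule kolmogorov.P.indep_vars_cong[THEN iffD1, rotated -1]) (simp_all add: prev)
qed

theorem levy_process_with_exponent_process:
  "levy_process_with_exponent path_measure process g"
  unfolding levy_process_with_exponent_def levy_process_def
proof (intro conjI allI impI)
  show "prob_space path_measure" by (rule kolmogorov.P.prob_space_axioms)
  show "process u \<in> borel_measurable path_measure" for u by simp
  show "AE \<omega> in path_measure. process 0 \<omega> = 0" by (simp add: process_def)
  show "distr path_measure borel (\<lambda>\<omega>. process b \<omega> - process a \<omega>)
      = distr path_measure borel (process (b - a))" if "0 \<le> a" "a < b" for a b
    using that by (simp add: distr_process_diff distr_process)
  show "char (distr path_measure borel (process u)) t = exp (of_real u * g t)" if "u \<ge> 0" for u t
    using that by (simp add: distr_process char_\<mu>)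
  show "kolmogorov.P.indep_vars (\<lambda>_. borel)
      (\<lambda>i \<omega>. process (\<tau> (Suc i)) \<omega> - process (\<tau> i) \<omega>) {..<n}"
    if "0 \<le> \<tau> 0" "\<forall>i<n. \<tau> i < \<tau> (Suc i)" for n :: nat and \<tau> :: "nat \<Rightarrow> real"
    using that by (intro indep_vars_increments_along) auto
qed (rule process_stochastically_continuous)

end

lemma levy_process_exists:
  assumes "\<And>u. u \<ge> 0 \<Longrightarrow> \<exists>M. real_distribution M \<and> char M = (\<lambda>t. exp (of_real u * g t))"
  shows "\<exists>(Q :: (real \<Rightarrow> real) measure) Z. levy_process_with_exponent Q Z g"
proof -
  \<comment> \<open>The normal distribution is merely a filler at negative times, making the chosen
    family total.\<close>
  have "\<exists>M. real_distribution M \<and> (u \<ge> 0 \<longrightarrow> char M = (\<lambda>t. exp (of_real u * g t)))" for u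
    using assms[of u] real_dist_normal_dist by (cases "u \<ge> 0") auto
  then have "\<forall>u. \<exists>M. real_distribution M \<and> (u \<ge> 0 \<longrightarrow> char M = (\<lambda>t. exp (of_real u * g t)))" ..
  then obtain \<mu> where
    \<mu>: "\<forall>u. real_distribution (\<mu> u) \<and> (u \<ge> 0 \<longrightarrow> char (\<mu> u) = (\<lambda>t. exp (of_real u * g t)))"
    by (rule choice[THEN exE])
  interpret convolution_semigroup \<mu> g
    by (rule convolution_semigroup.intro) (use \<mu> in auto)
  show ?thesis
    by (intro exI) (rule levy_process_with_exponent_process)
qed

section \<open>Characteristic functions of normalized geometric sums\<close>

text \<open>Replacing \<open>1 + w n\<close> by \<open>exp (w n)\<close> costs at most a constant
  times \<open>m n * (norm (w n))^2\<close>, of order \<open>n^2 * q ^ n\<close>. After this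
  replacement the power is a single exponential, in which the drift cancels against the centering up
  to \<open>a * n * (m n * q ^ n - u)\<close>. The value \<open>a = 0\<close> covers the limit
  without centering.\<close>

lemma power_tendsto_exp_drift:
  fixes H :: "nat \<Rightarrow> complex" and a q u :: real
  defines "w \<equiv> \<lambda>n. of_real (q ^ n) * (H n + \<i> * of_real (a * real n))"
  assumes q: "0 < q" "q < 1" and u: "u \<ge> 0"
    and le1: "\<And>n. norm (1 + w n) \<le> 1"
    and H: "H \<longlonglongrightarrow> h"
  shows "(\<lambda>n. (1 + w n) ^ nat \<lfloor>u * (1 / q) ^ n\<rfloor> * iexp (- (a * u * real n))) \<longlonglongrightarrow> exp (of_real u * h)"
proof -
  define m where "m n = nat \<lfloor>u * (1 / q) ^ n\<rfloor>" for n
  define c where "c n = real (m n) * q ^ n" for n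
  \<comment> \<open>\<open>G\<close> grows linearly; one factor \<open>b ^ n\<close> of \<open>q ^ n\<close> absorbs this growth.\<close>
  define b where "b = sqrt q"
  define G where "G n = H n + \<i> * of_real (a * real n)" for n
  have b: "0 < b" "b < 1" "b ^ n * b ^ n = q ^ n" for n
    using q by (auto simp: b_def power_mult_distrib[symmetric])
  \<comment> \<open>Rounding down costs at most 1 in \<open>m n\<close>, hence at most
    \<open>q ^ n\<close> in \<open>c n\<close>.\<close>
  have c: "u - q ^ n \<le> c n" "c n \<le> u" "0 \<le> c n" for n
  proof -
    have "u * (1 / q) ^ n \<ge> 0" using u q by simp
    then have "real (m n) \<le> u * (1 / q) ^ n" "u * (1 / q) ^ n - 1 \<le> real (m n)"
      unfolding m_def by linarith+
    moreover have "(1 / q) ^ n * q ^ n = 1" using q by (simp add: power_divide)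
    ultimately show "u - q ^ n \<le> c n" "c n \<le> u"
      using mult_right_mono[of "real (m n)" "u * (1 / q) ^ n" "q ^ n"]
        mult_right_mono[of "u * (1 / q) ^ n - 1" "real (m n)" "q ^ n"] q
      by (simp_all add: c_def left_diff_distrib mult.assoc)
    show "0 \<le> c n" using q by (simp add: c_def)
  qed
  have q0: "(\<lambda>n. q ^ n) \<longlonglongrightarrow> 0" using q by (intro LIMSEQ_power_zero) simp
  have nq0: "(\<lambda>n. real n * x ^ n) \<longlonglongrightarrow> 0" if "0 < x" "x < 1" for x :: real
    using powser_times_n_limit_0[of x] that by simp
  have "(\<lambda>n. of_real (b ^ n) * H n + \<i> * of_real (a * (real n * b ^ n))) \<longlonglongrightarrow> of_real 0 * h + \<i> * of_real (a * 0)"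
    using b by (intro tendsto_intros H nq0 LIMSEQ_power_zero) auto
  then have bG: "(\<lambda>n. of_real (b ^ n) * G n) \<longlonglongrightarrow> 0"
    by (simp add: G_def algebra_simps)
  have w_eq: "w n = of_real (b ^ n) * (of_real (b ^ n) * G n)" for n
    unfolding w_def G_def[symmetric] mult.assoc[symmetric] of_real_mult[symmetric] b(3) ..
  have "(\<lambda>n. of_real (b ^ n) * (of_real (b ^ n) * G n)) \<longlonglongrightarrow> of_real 0 * 0"
    using b by (intro tendsto_mult bG tendsto_of_real LIMSEQ_power_zero) auto
  then have w0: "w \<longlonglongrightarrow> 0" by (simp add: w_eq[abs_def])
  \<comment> \<open>This puts \<open>exp (w n)\<close> into the closed unit disc along with
    \<open>1 + w n\<close>; there m-th powers differ by at most m times the difference of the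
    bases.\<close>
  have Re_w: "Re (w n) \<le> 0" for n
    using complex_Re_le_cmod[of "1 + w n"] le1[of n] by simp
  have bound: "norm ((1 + w n) ^ m n - exp (w n) ^ m n)
      \<le> u * (exp \<bar>Re (w n)\<bar> * (norm (of_real (b ^ n) * G n))\<^sup>2)" for n
  proof -
    have "norm ((1 + w n) ^ m n - exp (w n) ^ m n) \<le> real (m n) * norm ((1 + w n) - exp (w n))"
      by (rule norm_power_diff) (use le1 Re_w in \<open>auto simp: norm_exp_eq_Re\<close>)
    also have "\<dots> \<le> real (m n) * (exp \<bar>Re (w n)\<bar> * (norm (w n))\<^sup>2)"
      using Taylor_exp[of "w n" 1]
      by (intro mult_left_mono) (simp_all add: norm_minus_commute numeral_2_eq_2)
    \<comment> \<open>One factor \<open>q ^ n\<close> is spent on turning \<open>m n\<close> into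
      the bounded \<open>c n\<close>; the other stays inside the square, where it makes
      \<open>b ^ n * G n\<close> vanish.\<close>
    also have "(norm (w n))\<^sup>2 = q ^ n * (norm (of_real (b ^ n) * G n))\<^sup>2"
      unfolding w_eq using b(1) by (simp add: norm_mult norm_power power2_eq_square b(3)[symmetric])
    also have "real (m n) * (exp \<bar>Re (w n)\<bar> * (q ^ n * (norm (of_real (b ^ n) * G n))\<^sup>2))
        = c n * (exp \<bar>Re (w n)\<bar> * (norm (of_real (b ^ n) * G n))\<^sup>2)"
      by (simp add: c_def)
    also have "\<dots> \<le> u * (exp \<bar>Re (w n)\<bar> * (norm (of_real (b ^ n) * G n))\<^sup>2)"
      by (rule mult_right_mono) (use c in auto)
    finally show ?thesis .
  qed
  have "(\<lambda>n. u * (exp \<bar>Re (w n)\<bar> * (norm (of_real (b ^ n) * G n))\<^sup>2))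
      \<longlonglongrightarrow> u * (exp \<bar>Re 0\<bar> * (norm (0::complex))\<^sup>2)"
    by (intro tendsto_intros w0 bG)
  then have "(\<lambda>n. u * (exp \<bar>Re (w n)\<bar> * (norm (of_real (b ^ n) * G n))\<^sup>2)) \<longlonglongrightarrow> 0"
    by simp
  from Lim_null_comparison[OF always_eventually[OF allI[OF bound]] this]
  have diff0: "(\<lambda>n. (1 + w n) ^ m n - exp (w n) ^ m n) \<longlonglongrightarrow> 0" .
  have "norm (((1 + w n) ^ m n - exp (w n) ^ m n) * iexp (- (a * u * real n)))
      \<le> norm ((1 + w n) ^ m n - exp (w n) ^ m n)" for n
    by (simp add: norm_mult del: of_real_mult of_real_minus)
  from Lim_null_comparison[OF always_eventually[OF allI[OF this]] tendsto_norm_zero[OF diff0]]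
  have "(\<lambda>n. ((1 + w n) ^ m n - exp (w n) ^ m n) * iexp (- (a * u * real n))) \<longlonglongrightarrow> 0" .
  moreover have "(\<lambda>n. exp (w n) ^ m n * iexp (- (a * u * real n))) \<longlonglongrightarrow> exp (of_real u * h)"
  proof -
    have cu: "c \<longlonglongrightarrow> u"
    proof -
      have "(\<lambda>n. u - q ^ n) \<longlonglongrightarrow> u" using tendsto_diff[OF tendsto_const q0, of u] by simp
      from real_tendsto_sandwich[OF always_eventually[OF allI[OF c(1)]]
          always_eventually[OF allI[OF c(2)]] this tendsto_const]
      show ?thesis .
    qed
    \<comment> \<open>This is the phase left over by the centering: linear growth against an error
      of at most \<open>q ^ n\<close>.\<close>
    have "(\<lambda>n. real n * (c n - u)) \<longlonglongrightarrow> 0"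
    proof (rule Lim_null_comparison[OF always_eventually nq0[OF q]], rule allI)
      fix n
      have "\<bar>c n - u\<bar> \<le> q ^ n" using c[of n] by linarith
      then show "norm (real n * (c n - u)) \<le> real n * q ^ n" by (simp add: abs_mult mult_left_mono)
    qed
    then have "(\<lambda>n. exp (of_real (c n) * H n + \<i> * of_real (a * (real n * (c n - u)))))
        \<longlonglongrightarrow> exp (of_real u * h + \<i> * of_real (a * 0))"
      by (intro tendsto_intros cu H)
    moreover have "exp (w n) ^ m n * iexp (- (a * u * real n))
        = exp (of_real (c n) * H n + \<i> * of_real (a * (real n * (c n - u))))" for n
      by (simp add: exp_of_nat_mult[symmetric] exp_add[symmetric] w_def c_def algebra_simps)
    ultimately show ?thesis by simp
  qed
  ultimately have "(\<lambda>n. ((1 + w n) ^ m n - exp (w n) ^ m n) * iexp (- (a * u * real n))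
      + exp (w n) ^ m n * iexp (- (a * u * real n))) \<longlonglongrightarrow> 0 + exp (of_real u * h)"
    by (rule tendsto_add)
  then show ?thesis by (simp add: m_def algebra_simps)
qed

section \<open>Characteristic functions of discrete laws and of sums\<close>

text \<open>The masses add up to 1, so almost every point is one of the \<open>c k\<close>, and
  there \<open>iexp (t * x)\<close> is the sum of its restrictions to the atoms. The integrals of
  the norms are the masses themselves, which justifies integrating termwise.\<close>

lemma (in real_distribution) char_atoms_sums:
  assumes inj: "inj c" and atoms: "\<And>k. measure M {c k} = v k" and v: "v sums 1"
  shows "(\<lambda>k::nat. of_real (v k) * iexp (t * c k)) sums char M t"
proof -
  define f where "f k x = indicator {c k} x *\<^sub>R iexp (t * c k)" for k x
  have "(\<lambda>k. measure M {c k}) sums measure M (\<Union>k. {c k})"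
    by (rule finite_measure_UNION) (use inj in \<open>auto simp: disjoint_family_on_def inj_on_def\<close>)
  with v have "prob (\<Union>k. {c k}) = 1" by (simp add: atoms sums_unique2)
  then have AE: "AE x in M. x \<in> (\<Union>k. {c k})" by (rule AE_prob_1)
  have int: "integrable M (f k)" for k
    unfolding f_def by (rule integrable_const_bound[where B = 1]) (auto split: split_indicator simp del: of_real_mult)
  have integral_f: "integral\<^sup>L M (f k) = of_real (v k) * iexp (t * c k)" for k
    unfolding f_def by (simp add: atoms scaleR_conv_of_real)
  have fin: "finite {k. x = c k}" for x
    using finite_vimageI[OF _ inj, of "{x}"] by (simp add: vimage_def eq_commute)
  have sm: "AE x in M. summable (\<lambda>k. norm (f k x))"
    by (intro AE_I2 summable_finite[OF fin]) (auto simp: f_def split: split_indicator)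
  have "(\<integral>x. norm (f k x) \<partial>M) = v k" for k
    unfolding f_def by (simp add: atoms del: of_real_mult)
  then have sn: "summable (\<lambda>k. \<integral>x. norm (f k x) \<partial>M)"
    using v by (simp add: sums_iff)
  have "char M t = (\<integral>x. (\<Sum>k. f k x) \<partial>M)"
    unfolding char_def
  proof (rule integral_cong_AE)
    show "(\<lambda>x. \<Sum>k. f k x) \<in> borel_measurable M"
      using int by (intro borel_measurable_suminf) auto
    show "AE x in M. iexp (t * x) = (\<Sum>k. f k x)"
      using AE
    proof eventually_elim
      case (elim x)
      then obtain j where x: "x = c j" by auto
      have "(\<lambda>k. f k x) = (\<lambda>k. if k = j then iexp (t * c j) else 0)"
        using inj by (auto simp: f_def x fun_eq_iff inj_eq split: split_indicator)
      then have "(\<Sum>k. f k x) = iexp (t * c j)"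
        using sums_single[of j "\<lambda>_. iexp (t * c j)"] by (simp add: sums_iff)
      then show ?case by (simp add: x)
    qed
  qed simp
  also have "\<dots> = (\<Sum>k. integral\<^sup>L M (f k))"
    by (rule integral_suminf[OF int sm sn])
  finally show ?thesis
    using summable_integral[OF int sm sn] by (simp add: integral_f sums_iff)
qed

lemma (in prob_space) char_normalized_sum:
  fixes X :: "nat \<Rightarrow> 'a \<Rightarrow> real"
  assumes indep: "indep_vars (\<lambda>_. borel) X {1..}"
    and ident: "\<And>i. i \<ge> 1 \<Longrightarrow> distr M borel (X i) = distr M borel (X 1)"
  shows "char (distr M borel (\<lambda>\<omega>. (\<Sum>k=1..m. X k \<omega>) / a - b)) t
    = char (distr M borel (X 1)) (t / a) ^ m * iexp (- (t * b))"
proof -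
  define S where "S \<omega> = (\<Sum>k=1..m. X k \<omega>)" for \<omega>
  have [measurable]: "S \<in> borel_measurable M"
    unfolding S_def using indep by (intro borel_measurable_sum) (auto simp: indep_vars_def)
  have "char (distr M borel (\<lambda>\<omega>. S \<omega> / a - b)) t
      = (CLINT \<omega>|M. iexp (t * (S \<omega> / a - b)))"
    unfolding char_def by (subst integral_distr) simp_all
  also have "\<dots> = (CLINT \<omega>|M. iexp (t / a * S \<omega>) * iexp (- (t * b)))"
    by (simp add: exp_add[symmetric] algebra_simps)
  also have "\<dots> = char (distr M borel S) (t / a) * iexp (- (t * b))"
    unfolding char_def by (subst integral_distr) simp_all
  also have "char (distr M borel S) (t / a) = (\<Prod>k=1..m. char (distr M borel (X k)) (t / a))"
    unfolding S_def
    by (rule char_distr_sum) (rule indep_vars_subset[OF indep], auto)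
  also have "\<dots> = (\<Prod>k=1..m. char (distr M borel (X 1)) (t / a))"
    by (intro prod.cong refl arg_cong[where f = "\<lambda>N. char N (t / a)"] ident) auto
  finally show ?thesis by (simp add: S_def)
qed

text \<open>The Weierstrass test is confined to \<open>[-1, 1]\<close> because the bounds for small
  jumps carry a factor \<open>\<bar>t\<bar>\<close> or \<open>t^2\<close>, which must be made
  independent of \<open>t\<close>.\<close>

lemma isCont_suminf:
  fixes f :: "nat \<Rightarrow> real \<Rightarrow> complex"
  assumes "\<And>i. continuous_on {-1..1} (f i)" "summable K"
    and "\<And>i t. \<bar>t\<bar> \<le> 1 \<Longrightarrow> norm (f i t) \<le> K i"
  shows "isCont (\<lambda>t. \<Sum>i. f i t) 0"
proof -
  have "uniform_limit {-1..1} (\<lambda>n t. \<Sum>i<n. f i t) (\<lambda>t. \<Sum>i. f i t) sequentially"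
    by (rule Weierstrass_m_test[OF _ assms(2)]) (use assms(3) in \<open>simp add: abs_le_iff\<close>)
  then have "continuous_on {-1..1} (\<lambda>t. \<Sum>i. f i t)"
    by (rule uniform_limit_theorem[rotated]) (auto intro!: always_eventually continuous_on_sum assms(1))
  then show ?thesis
    by (rule continuous_on_interior) simp
qed

lemma has_sum_int_atLeast_0:
  fixes f :: "int \<Rightarrow> complex"
  assumes "summable (\<lambda>i. norm (f (int i)))"
  shows "(f has_sum (\<Sum>i. f (int i))) {0..}"
proof -
  have "{0..} = range int"
  proof (intro equalityI subsetI)
    fix x :: int assume "x \<in> {0..}"
    then have "x = int (nat x)" by simp
    then show "x \<in> range int" by blast
  qed auto
  moreover have "((f \<circ> int) has_sum (\<Sum>i. f (int i))) UNIV"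
    unfolding o_def by (rule norm_summable_imp_has_sum[OF assms summable_sums[OF summable_norm_cancel[OF assms]]])
  ultimately show ?thesis by (simp add: has_sum_reindex)
qed

text \<open>The enumeration \<open>- 1 - int i\<close> turns the unordered sum into a series whose
  first n terms are exactly the indices from \<open>- n\<close> to \<open>- 1\<close>, the range
  present after scaling by \<open>r ^ n\<close>.\<close>

lemma has_sum_int_negative:
  fixes f :: "int \<Rightarrow> complex"
  assumes "summable (\<lambda>i. norm (f (- 1 - int i)))"
  shows "(f has_sum (\<Sum>i. f (- 1 - int i))) {..-1}"
proof -
  have "{..-1} = (\<lambda>i. - 1 - int i) ` UNIV"
  proof (intro equalityI subsetI)
    fix x :: int assume "x \<in> {..-1}"
    then have "x = - 1 - int (nat (- 1 - x))" by simp
    then show "x \<in> range (\<lambda>i. - 1 - int i)" by blast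
  qed auto
  moreover have "((f \<circ> (\<lambda>i. - 1 - int i)) has_sum (\<Sum>i. f (- 1 - int i))) UNIV"
    unfolding o_def by (rule norm_summable_imp_has_sum[OF assms summable_sums[OF summable_norm_cancel[OF assms]]])
  ultimately show ?thesis by (simp add: has_sum_reindex inj_on_def)
qed

lemma norm_iexp_minus_1: "norm (iexp x - 1) \<le> \<bar>x\<bar>"
  using iexp_approx1[of x 0] by simp

lemma norm_iexp_minus_1_minus: "norm (iexp x - 1 - \<i> * of_real x) \<le> x\<^sup>2 / 2"
  using iexp_approx1[of x 1] by (simp add: diff_diff_eq numeral_2_eq_2)

lemma power_int_neg_Suc: "x powi (- 1 - int i) = (1 / x :: real) ^ Suc i"
proof -
  have "x powi (- int (Suc i)) = (1 / x) ^ Suc i"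
    by (simp only: power_int_minus power_int_of_nat) (simp add: field_simps)
  then show ?thesis by simp
qed

section \<open>The geometric jump law and its two exponents\<close>

text \<open>This is the law of a single summand, with exponents counted from 0 instead of 1. Both
  regimes have \<open>r \<ge> 1 / q > 1\<close>, so \<open>r > 1\<close> may be assumed
  throughout.\<close>

locale petersburg = real_distribution M for M :: "real measure" +
  fixes p q s r :: real
  assumes p: "0 < p" "p < 1" and q_def: "q = 1 - p" and s: "s > 0" and r: "r > 1"
    and atoms: "\<And>k. measure M {s * r ^ k} = p * q ^ k"
begin

lemma q: "0 < q" "q < 1" using p q_def by auto

text \<open>The Levy measure of the limit puts mass \<open>p * q powi k\<close> at
  \<open>s * r powi k\<close> for every integer \<open>k\<close>. \<open>jump\<close> is the
  contribution of one atom to the exponent, \<open>cjump\<close> its compensated form; negative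
  \<open>k\<close> are the small jumps.\<close>

definition jump :: "real \<Rightarrow> int \<Rightarrow> complex" where
  "jump t k = (iexp (t * s * r powi k) - 1) * of_real (p * q powi k)"

definition cjump :: "real \<Rightarrow> int \<Rightarrow> complex" where
  "cjump t k = (iexp (t * s * r powi k) - 1 - \<i> * of_real (t * s * r powi k)) * of_real (p * q powi k)"

lemma norm_jump_le: "norm (jump t (int i)) \<le> 2 * p * q ^ i"
proof -
  have "norm (iexp x - 1) \<le> 2" for x
    using norm_triangle_ineq4[of "iexp x" 1] by simp
  then have "norm (jump t (int i)) \<le> 2 * \<bar>p * q ^ i\<bar>"
    unfolding jump_def norm_mult norm_of_real power_int_of_nat by (rule mult_right_mono) simp
  then show ?thesis using p q by (simp add: abs_mult)
qed

lemma norm_jump_neg_le: "norm (jump t (- 1 - int i)) \<le> \<bar>t\<bar> * (s * p * (1 / (r * q)) ^ Suc i)"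
proof -
  have "norm (jump t (- 1 - int i)) \<le> \<bar>t * s * r powi (- 1 - int i)\<bar> * \<bar>p * q powi (- 1 - int i)\<bar>"
    unfolding jump_def norm_mult norm_of_real by (rule mult_right_mono[OF norm_iexp_minus_1]) simp
  also have "\<dots> = \<bar>t\<bar> * (s * p * ((1 / r) ^ Suc i * (1 / q) ^ Suc i))"
    using p q s r unfolding power_int_neg_Suc by (simp add: abs_mult)
  also have "(1 / r) ^ Suc i * (1 / q) ^ Suc i = (1 / (r * q)) ^ Suc i"
    by (simp add: power_mult_distrib[symmetric] del: power_Suc)
  finally show ?thesis .
qed

text \<open>Compensation makes the bound quadratic in the jump size, so the ratio is
  \<open>1 / (r^2 * q)\<close>. At \<open>r * q = 1\<close> this equals \<open>1 / r\<close>,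
  whereas the uncompensated bound has ratio 1 and gives no convergence.\<close>

lemma norm_cjump_neg_le: "norm (cjump t (- 1 - int i)) \<le> t\<^sup>2 * (s\<^sup>2 * p / 2 * (1 / (r\<^sup>2 * q)) ^ Suc i)"
proof -
  have "norm (cjump t (- 1 - int i)) \<le> (t * s * r powi (- 1 - int i))\<^sup>2 / 2 * \<bar>p * q powi (- 1 - int i)\<bar>"
    unfolding cjump_def norm_mult norm_of_real by (rule mult_right_mono[OF norm_iexp_minus_1_minus]) simp
  also have "\<dots> = t\<^sup>2 * (s\<^sup>2 * p / 2 * (((1 / r) ^ Suc i)\<^sup>2 * (1 / q) ^ Suc i))"
    using p q s r unfolding power_int_neg_Suc
    by (simp add: abs_mult power_mult_distrib del: power_Suc)
  also have "((1 / r) ^ Suc i)\<^sup>2 * (1 / q) ^ Suc i = (1 / (r\<^sup>2 * q)) ^ Suc i"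
    by (simp add: power_divide power_mult_distrib power2_eq_square del: power_Suc)
  finally show ?thesis .
qed

lemma summable_jump_bound: "summable (\<lambda>i. 2 * p * q ^ i)"
  using q by (intro summable_mult summable_geometric) simp

lemma summable_jump_neg_bound: "r * q > 1 \<Longrightarrow> summable (\<lambda>i. s * p * (1 / (r * q)) ^ Suc i)"
  by (intro summable_mult summable_Suc_iff[THEN iffD2] summable_geometric) (simp add: field_simps)

lemma summable_cjump_neg_bound: "r\<^sup>2 * q > 1 \<Longrightarrow> summable (\<lambda>i. s\<^sup>2 * p / 2 * (1 / (r\<^sup>2 * q)) ^ Suc i)"
  by (intro summable_mult summable_Suc_iff[THEN iffD2] summable_geometric) (simp add: field_simps)

lemma summable_jump: "summable (\<lambda>i. norm (jump t (int i)))"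
  by (rule summable_comparison_test'[OF summable_jump_bound]) (use norm_jump_le in simp)

lemma summable_jump_neg:
  assumes "r * q > 1"
  shows "summable (\<lambda>i. norm (jump t (- 1 - int i)))"
  by (rule summable_comparison_test'[OF summable_mult[OF summable_jump_neg_bound[OF assms], of "\<bar>t\<bar>"]])
     (use norm_jump_neg_le in simp)

lemma summable_cjump_neg:
  assumes "r\<^sup>2 * q > 1"
  shows "summable (\<lambda>i. norm (cjump t (- 1 - int i)))"
  by (rule summable_comparison_test'[OF summable_mult[OF summable_cjump_neg_bound[OF assms], of "t\<^sup>2"]])
     (use norm_cjump_neg_le in simp)

lemma exponent_i_eq:
  assumes "r\<^sup>2 * q > 1"
  shows "exponent_i p q s r t = (\<Sum>i. cjump t (- 1 - int i)) + (\<Sum>i. jump t (int i))"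
  unfolding exponent_i_def jump_def[symmetric] cjump_def[symmetric]
  by (simp only: infsumI[OF has_sum_int_negative[OF summable_cjump_neg[OF assms]]]
      infsumI[OF has_sum_int_atLeast_0[OF summable_jump]])

lemma exponent_ii_eq:
  assumes "r * q > 1"
  shows "exponent_ii p q s r t = (\<Sum>i. jump t (- 1 - int i)) + (\<Sum>i. jump t (int i))"
proof -
  have "(jump t has_sum ((\<Sum>i. jump t (- 1 - int i)) + (\<Sum>i. jump t (int i)))) ({..-1} \<union> {0..})"
    by (intro has_sum_Un_disjoint has_sum_int_negative has_sum_int_atLeast_0
        summable_jump summable_jump_neg assms) auto
  moreover have "{..-1} \<union> {0..} = (UNIV :: int set)" by auto
  ultimately show ?thesis
    unfolding exponent_ii_def jump_def[symmetric] by (simp add: infsumI)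
qed

lemma isCont_sum_jump: "isCont (\<lambda>t. \<Sum>i. jump t (int i)) 0"
  by (rule isCont_suminf[OF _ summable_jump_bound norm_jump_le])
     (unfold jump_def, intro continuous_intros)

lemma isCont_exponent_i:
  assumes "r\<^sup>2 * q > 1"
  shows "isCont (exponent_i p q s r) 0"
proof -
  have "isCont (\<lambda>t. \<Sum>i. cjump t (- 1 - int i)) 0"
  proof (rule isCont_suminf[OF _ summable_cjump_neg_bound[OF assms]])
    fix t :: real and i assume "\<bar>t\<bar> \<le> 1"
    then have "t\<^sup>2 \<le> 1" by (simp add: abs_square_le_1)
    then have "t\<^sup>2 * (s\<^sup>2 * p / 2 * (1 / (r\<^sup>2 * q)) ^ Suc i) \<le> 1 * (s\<^sup>2 * p / 2 * (1 / (r\<^sup>2 * q)) ^ Suc i)"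
      by (rule mult_right_mono) (use p q s r in simp)
    with norm_cjump_neg_le[of t i]
    show "norm (cjump t (- 1 - int i)) \<le> s\<^sup>2 * p / 2 * (1 / (r\<^sup>2 * q)) ^ Suc i" by linarith
  qed (unfold cjump_def, intro continuous_intros)
  then show ?thesis
    unfolding exponent_i_eq[OF assms, abs_def] by (intro continuous_add isCont_sum_jump)
qed

lemma isCont_exponent_ii:
  assumes "r * q > 1"
  shows "isCont (exponent_ii p q s r) 0"
proof -
  have "isCont (\<lambda>t. \<Sum>i. jump t (- 1 - int i)) 0"
  proof (rule isCont_suminf[OF _ summable_jump_neg_bound[OF assms]])
    fix t :: real and i assume "\<bar>t\<bar> \<le> 1"
    then have "\<bar>t\<bar> * (s * p * (1 / (r * q)) ^ Suc i) \<le> 1 * (s * p * (1 / (r * q)) ^ Suc i)"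
      by (rule mult_right_mono) (use p q s r in simp)
    with norm_jump_neg_le[of t i]
    show "norm (jump t (- 1 - int i)) \<le> s * p * (1 / (r * q)) ^ Suc i" by linarith
  qed (unfold jump_def, intro continuous_intros)
  then show ?thesis
    unfolding exponent_ii_eq[OF assms, abs_def] by (intro continuous_add isCont_sum_jump)
qed

text \<open>The identity is exact for each n: subtracting the total mass 1 termwise, as the series
  of \<open>p * q ^ k\<close>, leaves \<open>q ^ n * jump t (k - n)\<close>. The indices
  \<open>k < n\<close> give the small jumps.\<close>

lemma char_scaled:
  "char M (t / r ^ n)
    = 1 + of_real (q ^ n) * ((\<Sum>i<n. jump t (- 1 - int i)) + (\<Sum>i. jump t (int i)))"
proof -
  have geom: "(\<lambda>k. p * q ^ k) sums 1"
    using sums_mult[OF geometric_sums[of q], of p] p q q_def by simp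
  have inj: "inj (\<lambda>k. s * r ^ k)"
    using s r by (auto simp: inj_on_def)
  have "(\<lambda>k. of_real (p * q ^ k) * iexp (t / r ^ n * (s * r ^ k)) - of_real (p * q ^ k))
      sums (char M (t / r ^ n) - of_real 1)"
    by (intro sums_diff sums_of_real char_atoms_sums[OF inj] atoms geom)
  moreover have "of_real (p * q ^ k) * iexp (t / r ^ n * (s * r ^ k)) - of_real (p * q ^ k)
      = of_real (q ^ n) * jump t (int k - int n)" for k
  proof -
    have powi: "x powi (int k - int n) = x ^ k / x ^ n" if "x > 0" for x :: real
      using that by (simp add: power_int_diff)
    have eq: "t / r ^ n * (s * r ^ k) = t * s * r powi (int k - int n)"
      using powi[of r] r by simp
    have "p * q ^ k = q ^ n * (p * q powi (int k - int n))"
      using powi[of q] q by simp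
    then have eq': "complex_of_real (p * q ^ k) = of_real (q ^ n) * of_real (p * q powi (int k - int n))"
      by (simp only: of_real_mult)
    have "a * b * e - a * b = a * ((e - 1) * b)" for a b e :: complex
      by (simp add: algebra_simps)
    then show ?thesis
      unfolding jump_def eq eq' by blast
  qed
  ultimately have "(\<lambda>k. of_real (q ^ n) * jump t (int k - int n)) sums (char M (t / r ^ n) - 1)"
    by simp
  then have sum: "(\<lambda>k. jump t (int k - int n)) sums ((char M (t / r ^ n) - 1) / of_real (q ^ n))"
    using sums_mult[of _ _ "1 / of_real (q ^ n)"] q by fastforce
  have "(char M (t / r ^ n) - 1) / of_real (q ^ n)
      = (\<Sum>k. jump t (int (k + n) - int n)) + (\<Sum>k<n. jump t (int k - int n))"
    using suminf_split_initial_segment[OF sums_summable[OF sum], of n] sums_unique[OF sum] by simp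
  \<comment> \<open>Reversing the order makes this a partial sum of a series that does not depend on
    n.\<close>
  also have "(\<Sum>k<n. jump t (int k - int n)) = (\<Sum>i<n. jump t (int (n - Suc i) - int n))"
    by (rule sum.nat_diff_reindex[symmetric])
  also have "\<dots> = (\<Sum>i<n. jump t (- 1 - int i))"
    by (rule sum.cong) (auto intro!: arg_cong[where f = "jump t"])
  finally show ?thesis using q by (simp add: field_simps)
qed

lemma char_power_tendsto_ii:
  assumes "r * q > 1" "u \<ge> 0"
  shows "(\<lambda>n. char M (t / r ^ n) ^ nat \<lfloor>u * (1 / q) ^ n\<rfloor>)
    \<longlonglongrightarrow> exp (of_real u * exponent_ii p q s r t)"
proof -
  define H where "H n = (\<Sum>i<n. jump t (- 1 - int i)) + (\<Sum>i. jump t (int i))" for n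
  have "H \<longlonglongrightarrow> exponent_ii p q s r t"
    unfolding H_def exponent_ii_eq[OF assms(1)]
    by (intro tendsto_add tendsto_const summable_LIMSEQ summable_norm_cancel[OF summable_jump_neg] assms)
  \<comment> \<open>Besides rewriting the limit, this supplies the hypothesis \<open>le1\<close>:
    the base of the power is a value of a characteristic function.\<close>
  moreover have eq: "1 + of_real (q ^ n) * (H n + \<i> * of_real (0 * real n)) = char M (t / r ^ n)" for n
    by (simp add: H_def char_scaled)
  ultimately have "(\<lambda>n. (1 + of_real (q ^ n) * (H n + \<i> * of_real (0 * real n))) ^ nat \<lfloor>u * (1 / q) ^ n\<rfloor>
      * iexp (- (0 * u * real n))) \<longlonglongrightarrow> exp (of_real u * exponent_ii p q s r t)"
    by (intro power_tendsto_exp_drift q assms) (simp_all only: eq cmod_char_le_1)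
  then show ?thesis unfolding eq by simp
qed

lemma char_power_tendsto_i:
  assumes "r * q = 1" "u \<ge> 0"
  shows "(\<lambda>n. char M (t / r ^ n) ^ nat \<lfloor>u * (1 / q) ^ n\<rfloor> * iexp (- (t * (s * p * u * real n))))
    \<longlonglongrightarrow> exp (of_real u * exponent_i p q s r t)"
proof -
  \<comment> \<open>Here \<open>r^2 * q = r * (r * q) = r\<close>.\<close>
  have r2q: "r\<^sup>2 * q > 1" using assms(1) r by (simp add: power2_eq_square mult.assoc)
  define H where "H n = (\<Sum>i<n. cjump t (- 1 - int i)) + (\<Sum>i. jump t (int i))" for n
  have jump_eq: "jump t (- 1 - int i) = cjump t (- 1 - int i) + \<i> * of_real (t * s * p)" for i
  proof -
    have "(1 / r) ^ Suc i * (1 / q) ^ Suc i = (1 / (r * q)) ^ Suc i"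
      by (simp add: power_mult_distrib[symmetric])
    then have "r powi (- 1 - int i) * q powi (- 1 - int i) = 1"
      unfolding power_int_neg_Suc using assms(1) by simp
    then have "complex_of_real (t * s * p) = of_real (t * s * r powi (- 1 - int i)) * of_real (p * q powi (- 1 - int i))"
      unfolding of_real_mult[symmetric] by (simp add: mult_ac)
    then show ?thesis
      unfolding jump_def cjump_def by (simp only:) (simp add: algebra_simps)
  qed
  have "H \<longlonglongrightarrow> exponent_i p q s r t"
    unfolding H_def exponent_i_eq[OF r2q]
    by (intro tendsto_add tendsto_const summable_LIMSEQ summable_norm_cancel[OF summable_cjump_neg] r2q)
  moreover have eq: "1 + of_real (q ^ n) * (H n + \<i> * of_real (t * s * p * real n)) = char M (t / r ^ n)" for n
    by (simp add: H_def char_scaled jump_eq sum.distrib algebra_simps)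
  ultimately have "(\<lambda>n. (1 + of_real (q ^ n) * (H n + \<i> * of_real (t * s * p * real n))) ^ nat \<lfloor>u * (1 / q) ^ n\<rfloor>
      * iexp (- (t * s * p * u * real n))) \<longlonglongrightarrow> exp (of_real u * exponent_i p q s r t)"
    by (intro power_tendsto_exp_drift q assms) (simp_all only: eq cmod_char_le_1)
  then show ?thesis unfolding eq by (simp only: mult.assoc)
qed

end

section \<open>From characteristic functions to the limit theorem\<close>

lemma conv_in_distribution_of_char:
  assumes "prob_space P" "\<And>n. Y n \<in> borel_measurable P"
    and "prob_space Q" "W \<in> borel_measurable Q"
    and "\<And>t. (\<lambda>n. char (distr P borel (Y n)) t) \<longlonglongrightarrow> char (distr Q borel W) t"
  shows "conv_in_distribution P Y Q W"
  unfolding conv_in_distribution_def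
  by (rule levy_continuity) (use assms in \<open>auto intro: prob_space.real_distribution_distr\<close>)

text \<open>One convergence serves twice: as the source of the laws from which a process is built,
  and, through Levy continuity, as the limit theorem for any process with that exponent, on whatever
  space it lives. The case \<open>u = 0\<close> of \<open>lim\<close> provides the law at time 0 of
  the semigroup.\<close>

lemma levy_limit:
  fixes Y :: "real \<Rightarrow> nat \<Rightarrow> 'a \<Rightarrow> real" and Q :: "'b measure" and Z :: "real \<Rightarrow> 'b \<Rightarrow> real"
  assumes P: "prob_space P"
    and Y: "\<And>u n. Y u n \<in> borel_measurable P"
    and lim: "\<And>u t. u \<ge> 0 \<Longrightarrow> (\<lambda>n. char (distr P borel (Y u n)) t) \<longlonglongrightarrow> exp (of_real u * g t)"
    and cont: "isCont g 0"
  shows "\<exists>(Q' :: (real \<Rightarrow> real) measure) Z'. levy_process_with_exponent Q' Z' g"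
    and "levy_process_with_exponent Q Z g \<Longrightarrow> u > 0 \<Longrightarrow> conv_in_distribution P (Y u) Q (Z u)"
proof -
  show "\<exists>(Q' :: (real \<Rightarrow> real) measure) Z'. levy_process_with_exponent Q' Z' g"
  proof (rule levy_process_exists)
    fix u :: real assume u: "u \<ge> 0"
    show "\<exists>M. real_distribution M \<and> char M = (\<lambda>t. exp (of_real u * g t))"
    proof (rule char_limit_is_char)
      show "real_distribution (distr P borel (Y u n))" for n
        by (rule prob_space.real_distribution_distr[OF P Y])
      show "isCont (\<lambda>t. exp (of_real u * g t)) 0"
        by (intro continuous_intros cont)
    qed (rule lim[OF u])
  qed
  assume Z: "levy_process_with_exponent Q Z g" and u: "u > 0"
  then have "char (distr Q borel (Z u)) t = exp (of_real u * g t)" for t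
    by (simp add: levy_process_with_exponent_def)
  moreover have "prob_space Q" "Z u \<in> borel_measurable Q"
    using Z u by (auto simp: levy_process_with_exponent_def levy_process_def)
  ultimately show "conv_in_distribution P (Y u) Q (Z u)"
    using u by (intro conv_in_distribution_of_char P Y) (simp_all add: lim)
qed

text \<open>The convergence clauses concern an arbitrary process with the given exponent; the
  existence clauses show that such processes do occur.\<close>

theorem theorem2p2:
  fixes P :: "'a measure" and X :: "nat \<Rightarrow> 'a \<Rightarrow> real"
    and S :: "nat \<Rightarrow> 'a \<Rightarrow> real"
    and p q s r :: real
    and N M :: "nat \<Rightarrow> real"
    and Q :: "'b measure" and Z :: "real \<Rightarrow> 'b \<Rightarrow> real"
  assumes "0 < p" and "p < 1" and "q = 1 - p" and "s > 0" and "r > 0"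
    and "prob_space P"
    and indep: "prob_space.indep_vars P (\<lambda>_. borel) X {1..}"
    and ident: "\<And>i. i \<ge> 1 \<Longrightarrow> distr P borel (X i) = distr P borel (X 1)"
    and law: "\<And>k. k \<ge> 1 \<Longrightarrow>
      measure P {\<omega> \<in> space P. X 1 \<omega> = s * r ^ (k - 1)} = p * q ^ (k - 1)"
    and S_def: "\<And>m \<omega>. S m \<omega> = (\<Sum>k=1..m. X k \<omega>)"
    and N_def: "\<And>n. N n = r ^ n"
    and M_def: "\<And>n. M n = q powi (- int n)"
  shows
    "(r = 1 / q \<longrightarrow>
        (\<exists>(Q' :: (real \<Rightarrow> real) measure) Z'.
           levy_process_with_exponent Q' Z' (exponent_i p q s r)) \<and>
        (levy_process_with_exponent Q Z (exponent_i p q s r) \<longrightarrow>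
           (\<forall>u>0. conv_in_distribution P
              (\<lambda>n \<omega>. S (nat \<lfloor>u * N n\<rfloor>) \<omega> / N n - s * p * u * real n) Q (Z u)))) \<and>
     (r > 1 / q \<longrightarrow>
        (\<exists>(Q' :: (real \<Rightarrow> real) measure) Z'.
           levy_process_with_exponent Q' Z' (exponent_ii p q s r)) \<and>
        (levy_process_with_exponent Q Z (exponent_ii p q s r) \<longrightarrow>
           (\<forall>u>0.
              conv_in_distribution P
                (\<lambda>n \<omega>. S (nat \<lfloor>u * M n\<rfloor>) \<omega> / N n) Q (Z u) \<and>
              conv_in_distribution P
                (\<lambda>n \<omega>. 1 / (r * q) ^ n * (S (nat \<lfloor>u * M n\<rfloor>) \<omega> / M n)) Q (Z u))))"
proof -
  interpret P: prob_space P by fact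
  have X: "X i \<in> borel_measurable P" if "i \<ge> 1" for i
    using indep that by (auto simp: P.indep_vars_def)
  have S: "S m \<in> borel_measurable P" for m
    unfolding S_def[abs_def] by (intro borel_measurable_sum X) simp
  have q: "0 < q" "q < 1" using assms(1-3) by auto
  have MN: "M n = (1 / q) ^ n" "M n = 1 / q ^ n" for n
    by (simp_all add: M_def power_int_minus power_divide field_simps)
  have petersburg: "petersburg (distr P borel (X 1)) p q s r" if "r > 1"
  proof -
    have "measure (distr P borel (X 1)) {s * r ^ k} = p * q ^ k" for k
    proof -
      have "measure (distr P borel (X 1)) {s * r ^ k} = measure P (X 1 -` {s * r ^ k} \<inter> space P)"
        by (rule measure_distr) (use X[of 1] in auto)
      also have "X 1 -` {s * r ^ k} \<inter> space P = {\<omega> \<in> space P. X 1 \<omega> = s * r ^ (Suc k - 1)}"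
        by auto
      finally show ?thesis using law[of "Suc k"] by simp
    qed
    then show ?thesis
      using assms(1-4) that X[of 1]
      by (intro petersburg.intro petersburg_axioms.intro P.real_distribution_distr) auto
  qed
  have char_S: "char (distr P borel (\<lambda>\<omega>. S m \<omega> / a - b)) t
      = char (distr P borel (X 1)) (t / a) ^ m * iexp (- (t * b))" for m a b t
    unfolding S_def by (rule P.char_normalized_sum[OF indep ident])
  show ?thesis
  proof (intro conjI impI)
    assume r_eq: "r = 1 / q"
    then have r: "r > 1" "r * q = 1" using q by auto
    interpret X1: petersburg "distr P borel (X 1)" p q s r by (rule petersburg) fact
    have lim: "(\<lambda>n. char (distr P borel (\<lambda>\<omega>. S (nat \<lfloor>u * N n\<rfloor>) \<omega> / N n - s * p * u * real n)) t)
        \<longlonglongrightarrow> exp (of_real u * exponent_i p q s r t)" if "u \<ge> 0" for u t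
      unfolding char_S using X1.char_power_tendsto_i[OF r(2) that, of t]
      by (simp add: N_def r_eq)
    have "isCont (exponent_i p q s r) 0"
      by (rule X1.isCont_exponent_i) (use r in \<open>simp add: power2_eq_square mult.assoc\<close>)
    note limit = levy_limit[where Y = "\<lambda>u n \<omega>. S (nat \<lfloor>u * N n\<rfloor>) \<omega> / N n - s * p * u * real n",
        OF P.prob_space_axioms _ lim this]
    show "\<exists>(Q' :: (real \<Rightarrow> real) measure) Z'. levy_process_with_exponent Q' Z' (exponent_i p q s r)"
      by (rule limit(1)) (use S in simp_all)
    show "\<forall>u>0. conv_in_distribution P
        (\<lambda>n \<omega>. S (nat \<lfloor>u * N n\<rfloor>) \<omega> / N n - s * p * u * real n) Q (Z u)"
      if "levy_process_with_exponent Q Z (exponent_i p q s r)"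
      by (intro allI impI limit(2) that) (use S in simp_all)
  next
    assume r_gt: "r > 1 / q"
    then have rq: "r * q > 1" using q by (simp add: field_simps)
    have r: "r > 1" using r_gt q by (smt (verit) less_divide_eq_1_pos)
    interpret X1: petersburg "distr P borel (X 1)" p q s r by (rule petersburg) fact
    have lim: "(\<lambda>n. char (distr P borel (\<lambda>\<omega>. S (nat \<lfloor>u * M n\<rfloor>) \<omega> / N n)) t)
        \<longlonglongrightarrow> exp (of_real u * exponent_ii p q s r t)" if "u \<ge> 0" for u t
      using char_S[of _ _ 0 t] X1.char_power_tendsto_ii[OF rq that, of t]
      by (simp add: N_def MN(1))
    note limit = levy_limit[where Y = "\<lambda>u n \<omega>. S (nat \<lfloor>u * M n\<rfloor>) \<omega> / N n",
        OF P.prob_space_axioms _ lim X1.isCont_exponent_ii[OF rq]]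
    show "\<exists>(Q' :: (real \<Rightarrow> real) measure) Z'. levy_process_with_exponent Q' Z' (exponent_ii p q s r)"
      by (rule limit(1)) (use S in simp_all)
    \<comment> \<open>Since \<open>(r * q) ^ n * M n = r ^ n = N n\<close>, the two normalizations
      in the second regime give the same random variable.\<close>
    have rescale: "1 / (r * q) ^ n * (x / M n) = x / N n" for n x
      using q r by (simp add: MN(2) N_def power_mult_distrib)
    show "\<forall>u>0. conv_in_distribution P (\<lambda>n \<omega>. S (nat \<lfloor>u * M n\<rfloor>) \<omega> / N n) Q (Z u) \<and>
        conv_in_distribution P
          (\<lambda>n \<omega>. 1 / (r * q) ^ n * (S (nat \<lfloor>u * M n\<rfloor>) \<omega> / M n)) Q (Z u)"
      if "levy_process_with_exponent Q Z (exponent_ii p q s r)"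
      unfolding rescale using that S by (auto intro!: limit(2))
  qed
qed

end
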